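(* Up to first order interdefinability, the vector space $\mathbb{F}_2^\omega$ has exactly 4 first order definable reducts: (1) $\mathbb{F}_2^\omega$ itself, corresponding to the group $\operatorname{GL}(\omega,2)$ (i.e. having this automorphism group); (2) the affine space, corresponding to $\operatorname{AGL}$; (3) the structure with one unary relation $\{0\}$, corresponding to $\operatorname{Sym}_0(\mathbb{F}_2^\omega)$; (4) the trivial structure (with no relations), corresponding to $\operatorname{Sym}(\mathbb{F}_2^\omega)$.
   Context: $\mathbb{F}_2^\omega$ denotes the countably infinite dimensional vector space over the two element field, $\operatorname{GL}(\omega,2)$ its automorphism group, $\operatorname{Sym}(\mathbb{F}_2^\omega)$ the group of all permutations of its elements, and $\operatorname{Sym}_0(\mathbb{F}_2^\omega)$ the stabilizer of $0$ in it. $\operatorname{AGL}$ is the subgroup of $\operatorname{Sym}(\mathbb{F}_2^\omega)$ generated by $\operatorname{GL}(\omega,2)$ and all translations $v\mapsto v+a$; it is the automorphism group of the affine space obtained from $\mathbb{F}_2^\omega$, which can be viewed as the set $\mathbb{F}_2^\omega$ with the ternary addition $(a,b,c)\mapsto a+b+c$. A first order definable reduct of a structure is a relational structure on the same underlying set all of whose relations are first order definable (without parameters) in the original structure. Two structures on the same underlying set are first order interdefinable if each is a first order definable reduct of the other. Since $\mathbb{F}_2^\omega$ is $\omega$-categorical, taking automorphism groups gives a bijection between interdefinability classes of first order definable reducts and closed (in the pointwise convergence topology) subgroups of $\operatorname{Sym}(\mathbb{F}_2^\omega)$ containing $\operatorname{GL}(\omega,2)$. *)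

theory Defs
  imports Complex_Main "HOL-Library.Z2" "HOL-Library.Countable_Set" "HOL-Algebra.Bij" "HOL-Algebra.Generated_Groups"
begin

text \<open>
  The underlying set of a structure is always a whole type \<open>'a\<close>, so two structures have the same
  underlying set iff they have the same third type parameter.  The symbols that are actually present
  are given by \<open>fsyms\<close> and \<open>rsyms\<close> (HOL types are non-empty, signatures may be empty); the
  interpretations only matter on those symbols and on lists whose length is the arity.
\<close>

record ('f, 'r, 'a) fo_structure =
  fsyms :: "'f set"
  farity :: "'f \<Rightarrow> nat"
  finterp :: "'f \<Rightarrow> 'a list \<Rightarrow> 'a"
  rsyms :: "'r set"
  rarity :: "'r \<Rightarrow> nat"
  rinterp :: "'r \<Rightarrow> 'a list set"

datatype 'f fo_term = Var nat | App 'f "'f fo_term list"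

datatype ('f, 'r) fo_form =
    Eq "'f fo_term" "'f fo_term"
  | Rel 'r "'f fo_term list"
  | Neg "('f, 'r) fo_form"
  | Conj "('f, 'r) fo_form" "('f, 'r) fo_form"
  | Ex nat "('f, 'r) fo_form"

primrec wf_term :: "('f, 'r, 'a) fo_structure \<Rightarrow> 'f fo_term \<Rightarrow> bool" where
  "wf_term M (Var i) \<longleftrightarrow> True"
| "wf_term M (App f ts) \<longleftrightarrow> f \<in> fsyms M \<and> length ts = farity M f \<and> list_all (wf_term M) ts"

primrec wf_form :: "('f, 'r, 'a) fo_structure \<Rightarrow> ('f, 'r) fo_form \<Rightarrow> bool" where
  "wf_form M (Eq s t) \<longleftrightarrow> wf_term M s \<and> wf_term M t"
| "wf_form M (Rel r ts) \<longleftrightarrow> r \<in> rsyms M \<and> length ts = rarity M r \<and> list_all (wf_term M) ts"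
| "wf_form M (Neg \<phi>) \<longleftrightarrow> wf_form M \<phi>"
| "wf_form M (Conj \<phi> \<psi>) \<longleftrightarrow> wf_form M \<phi> \<and> wf_form M \<psi>"
| "wf_form M (Ex i \<phi>) \<longleftrightarrow> wf_form M \<phi>"

primrec fv_term :: "'f fo_term \<Rightarrow> nat set" where
  "fv_term (Var i) = {i}"
| "fv_term (App f ts) = \<Union> (set (map fv_term ts))"

primrec fv_form :: "('f, 'r) fo_form \<Rightarrow> nat set" where
  "fv_form (Eq s t) = fv_term s \<union> fv_term t"
| "fv_form (Rel r ts) = \<Union> (fv_term ` set ts)"
| "fv_form (Neg \<phi>) = fv_form \<phi>"
| "fv_form (Conj \<phi> \<psi>) = fv_form \<phi> \<union> fv_form \<psi>"
| "fv_form (Ex i \<phi>) = fv_form \<phi> - {i}"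

primrec eval :: "('f, 'r, 'a) fo_structure \<Rightarrow> (nat \<Rightarrow> 'a) \<Rightarrow> 'f fo_term \<Rightarrow> 'a" where
  "eval M e (Var i) = e i"
| "eval M e (App f ts) = finterp M f (map (eval M e) ts)"

primrec sat :: "('f, 'r, 'a) fo_structure \<Rightarrow> (nat \<Rightarrow> 'a) \<Rightarrow> ('f, 'r) fo_form \<Rightarrow> bool" where
  "sat M e (Eq s t) \<longleftrightarrow> eval M e s = eval M e t"
| "sat M e (Rel r ts) \<longleftrightarrow> map (eval M e) ts \<in> rinterp M r"
| "sat M e (Neg \<phi>) \<longleftrightarrow> \<not> sat M e \<phi>"
| "sat M e (Conj \<phi> \<psi>) \<longleftrightarrow> sat M e \<phi> \<and> sat M e \<psi>"
| "sat M e (Ex i \<phi>) \<longleftrightarrow> (\<exists>a. sat M (e(i := a)) \<phi>)"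

definition definable_relation ::
    "('f, 'r, 'a) fo_structure \<Rightarrow> nat \<Rightarrow> 'a list set \<Rightarrow> bool" where
  "definable_relation M n X \<longleftrightarrow>
     (\<exists>\<phi>. wf_form M \<phi> \<and> fv_form \<phi> \<subseteq> {..<n} \<and> X = {map e [0..<n] | e. sat M e \<phi>})"

text \<open>
  An operation of arity \<open>n\<close> counts as the relation of arity \<open>n + 1\<close> which is its graph, so that
  structures with operations (such as a vector space) can also be called reducts.  For
  structures without function symbols only the first part of the union remains.
\<close>

definition basic_relations :: "('f, 'r, 'a) fo_structure \<Rightarrow> (nat \<times> 'a list set) set" where
  "basic_relations M =
     {(rarity M r, {xs \<in> rinterp M r. length xs = rarity M r}) | r. r \<in> rsyms M} \<union>
     {(Suc (farity M f), {xs @ [finterp M f xs] | xs. length xs = farity M f}) | f. f \<in> fsyms M}"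

definition fo_reduct :: "('f, 'r, 'a) fo_structure \<Rightarrow> ('g, 's, 'a) fo_structure \<Rightarrow> bool" where
  "fo_reduct R M \<longleftrightarrow> (\<forall>(n, X) \<in> basic_relations R. definable_relation M n X)"

definition interdefinable :: "('f, 'r, 'a) fo_structure \<Rightarrow> ('g, 's, 'a) fo_structure \<Rightarrow> bool" where
  "interdefinable M N \<longleftrightarrow> fo_reduct M N \<and> fo_reduct N M"

definition Aut :: "('f, 'r, 'a) fo_structure \<Rightarrow> ('a \<Rightarrow> 'a) set" where
  "Aut M = {g. bij g \<and>
     (\<forall>f \<in> fsyms M. \<forall>xs. length xs = farity M f \<longrightarrow> g (finterp M f xs) = finterp M f (map g xs)) \<and>
     (\<forall>r \<in> rsyms M. \<forall>xs. length xs = rarity M r \<longrightarrow> (map g xs \<in> rinterp M r \<longleftrightarrow> xs \<in> rinterp M r))}"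

locale F2_omega = vector_space scale for scale :: "bit \<Rightarrow> 'v::ab_group_add \<Rightarrow> 'v" +
  assumes countably_infinite_basis:
    "\<exists>B. countable B \<and> infinite B \<and> independent B \<and> span B = UNIV"

datatype vector_op = VZero | VPlus | VScale bit

primrec vector_op_arity :: "vector_op \<Rightarrow> nat" where
  "vector_op_arity VZero = 0"
| "vector_op_arity VPlus = 2"
| "vector_op_arity (VScale c) = 1"

primrec vector_op_interp ::
    "(bit \<Rightarrow> 'v::ab_group_add \<Rightarrow> 'v) \<Rightarrow> vector_op \<Rightarrow> 'v list \<Rightarrow> 'v" where
  "vector_op_interp scale VZero xs = 0"
| "vector_op_interp scale VPlus xs = xs ! 0 + xs ! 1"
| "vector_op_interp scale (VScale c) xs = scale c (xs ! 0)"

definition vector_structure ::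
    "(bit \<Rightarrow> 'v::ab_group_add \<Rightarrow> 'v) \<Rightarrow> (vector_op, unit, 'v) fo_structure" where
  "vector_structure scale =
     \<lparr>fsyms = UNIV, farity = vector_op_arity, finterp = vector_op_interp scale,
      rsyms = {}, rarity = (\<lambda>_. 0), rinterp = (\<lambda>_. {})\<rparr>"

definition affine_structure :: "(unit, unit, 'v::ab_group_add) fo_structure" where
  "affine_structure =
     \<lparr>fsyms = UNIV, farity = (\<lambda>_. 3), finterp = (\<lambda>_ xs. xs ! 0 + xs ! 1 + xs ! 2),
      rsyms = {}, rarity = (\<lambda>_. 0), rinterp = (\<lambda>_. {})\<rparr>"

definition zero_structure :: "(unit, unit, 'v::ab_group_add) fo_structure" where
  "zero_structure =
     \<lparr>fsyms = {}, farity = (\<lambda>_. 0), finterp = (\<lambda>_ _. 0),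
      rsyms = UNIV, rarity = (\<lambda>_. 1), rinterp = (\<lambda>_. {[0]})\<rparr>"

definition trivial_structure :: "(unit, unit, 'v::ab_group_add) fo_structure" where
  "trivial_structure =
     \<lparr>fsyms = {}, farity = (\<lambda>_. 0), finterp = (\<lambda>_ _. 0),
      rsyms = {}, rarity = (\<lambda>_. 0), rinterp = (\<lambda>_. {})\<rparr>"

definition Sym :: "('v \<Rightarrow> 'v) set" where
  "Sym = {g. bij g}"

definition Sym\<^sub>0 :: "('v::zero \<Rightarrow> 'v) set" where
  "Sym\<^sub>0 = {g \<in> Sym. g 0 = 0}"

definition GL :: "(bit \<Rightarrow> 'v::ab_group_add \<Rightarrow> 'v) \<Rightarrow> ('v \<Rightarrow> 'v) set" where
  "GL scale = {g \<in> Sym. Vector_Spaces.linear scale scale g}"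

definition AGL :: "(bit \<Rightarrow> 'v::ab_group_add \<Rightarrow> 'v) \<Rightarrow> ('v \<Rightarrow> 'v) set" where
  "AGL scale = generate (BijGroup UNIV) (GL scale \<union> {(\<lambda>v. v + a) | a. True})"

end

theory Submission
  imports Defs "HOL-Combinatorics.Transposition"
begin

text \<open>
  Definable relations of a countable structure whose automorphism group has finitely many orbits on
  \<open>n\<close>-tuples are exactly the invariant ones (Ryll-Nardzewski), so it suffices to classify the closed
  groups \<open>G\<close> between \<open>GL\<close> and \<open>Sym\<close>.

  Suppose \<open>G\<close> fixes \<open>0\<close> and contains a nonlinear map.  Then every finite set \<open>S\<close> of nonzero vectors
  is mapped to an independent set by some element of \<open>G\<close>: by induction on its cardinality one may
  assume that \<open>S\<close> is an independent set \<open>B\<close> together with the sum of a subset of \<open>B\<close>, and if such a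
  set cannot be made independent, then all of \<open>G\<close> is additive on generic tuples, which is seen to
  contradict bijectivity.  Hence \<open>G\<close> is dense in \<open>Sym\<^sub>0\<close>.

  If \<open>G\<close> moves \<open>0\<close>, it is transitive, and the stabilizer of \<open>0\<close> is \<open>GL\<close> or \<open>Sym\<^sub>0\<close>.  In the latter
  case \<open>G = Sym\<close>; in the former, the stabilizer of three points in \<open>G\<close> has exactly one further fixed
  point, which must be their sum, so \<open>G\<close> preserves the ternary addition.
\<close>

unbundle no m_inv_syntax

section \<open>Types, invariance and definability\<close>

lemma eval_cong:
  assumes "\<And>i. i \<in> fv_term t \<Longrightarrow> e i = e' i"
  shows "eval M e t = eval M e' t"
  using assms
proof (induction t)
  case (App f ts)
  then have "map (eval M e) ts = map (eval M e') ts" by auto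
  then show ?case by (simp del: map_eq_conv)
qed auto

lemma sat_cong:
  assumes "\<And>i. i \<in> fv_form \<phi> \<Longrightarrow> e i = e' i"
  shows "sat M e \<phi> \<longleftrightarrow> sat M e' \<phi>"
  using assms
proof (induction \<phi> arbitrary: e e')
  case (Eq s t)
  then show ?case using eval_cong[of s e e' M] eval_cong[of t e e' M] by auto
next
  case (Rel r ts)
  then have "map (eval M e) ts = map (eval M e') ts"
    by (auto intro: eval_cong)
  then show ?case by (simp del: map_eq_conv)
next
  case (Conj \<phi> \<psi>)
  then show ?case by (metis UnCI fv_form.simps(4) sat.simps(4))
next
  case (Ex i \<phi>)
  have "sat M (e(i := a)) \<phi> \<longleftrightarrow> sat M (e'(i := a)) \<phi>" for a
    by (rule Ex.IH) (use Ex.prems in auto)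
  then show ?case by simp
next
  case (Neg \<phi>)
  then show ?case by (metis fv_form.simps(3) sat.simps(3))
qed

lemma finite_fv_term: "finite (fv_term t)"
  by (induction t) auto

lemma finite_fv_form: "finite (fv_form \<phi>)"
  by (induction \<phi>) (auto simp: finite_fv_term)

lemma eval_Aut:
  assumes "g \<in> Aut M" "wf_term M t"
  shows "eval M (\<lambda>i. g (e i)) t = g (eval M e t)"
  using assms(2)
proof (induction t)
  case (App f ts)
  then have "map (eval M (\<lambda>i. g (e i))) ts = map g (map (eval M e) ts)"
    by (auto simp: list_all_iff)
  then show ?case
    using assms(1) App.prems unfolding Aut_def by (simp del: map_map map_eq_conv)
qed auto

lemma sat_Aut:
  assumes g: "g \<in> Aut M" and "wf_form M \<phi>"
  shows "sat M (\<lambda>i. g (e i)) \<phi> \<longleftrightarrow> sat M e \<phi>"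
  using assms(2)
proof (induction \<phi> arbitrary: e)
  case (Eq s t)
  moreover have "inj g" using g by (simp add: Aut_def bij_is_inj)
  ultimately show ?case
    by (simp add: eval_Aut[OF g] inj_eq)
next
  case (Rel r ts)
  then have "map (eval M (\<lambda>i. g (e i))) ts = map g (map (eval M e) ts)"
    using eval_Aut[OF g] by (auto simp: list_all_iff)
  then show ?case
    using g Rel.prems unfolding Aut_def by (simp del: map_map map_eq_conv)
next
  case (Ex i \<phi>)
  have "(\<lambda>j. g (e j))(i := g a) = (\<lambda>j. g ((e(i := a)) j))" for a by auto
  then have "sat M ((\<lambda>j. g (e j))(i := g a)) \<phi> \<longleftrightarrow> sat M (e(i := a)) \<phi>" for a
    using Ex.prems by (simp only: Ex.IH wf_form.simps)
  \<comment> \<open>By surjectivity every candidate witness for the translated assignment has the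
    form \<open>g a\<close>.\<close>
  moreover have "surj g" using g by (auto simp: Aut_def bij_is_surj)
  ultimately show ?case by simp (metis surjD)
qed auto

lemma Aut_comp:
  assumes "g \<in> Aut M" "h \<in> Aut M"
  shows "g \<circ> h \<in> Aut M"
  using assms unfolding Aut_def by (auto simp: bij_comp simp flip: map_map)

lemma Aut_inv:
  assumes "g \<in> Aut M"
  shows "inv g \<in> Aut M"
proof -
  have bij: "bij g" using assms by (simp add: Aut_def)
  then have surj: "g (inv g x) = x" and inj: "inv g (g x) = x" for x
    by (simp_all add: bij_is_surj surj_f_inv_f bij_is_inj)
  have "map g (map (inv g) xs) = xs" for xs by (simp add: surj comp_def)
  then show ?thesis
    using assms bij inj unfolding Aut_def
    by (auto simp: bij_imp_bij_inv simp del: map_map) (metis length_map)+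
qed

text \<open>Each preservation condition concerns a single tuple, together with the value of the
  operation on it. An automorphism that agrees with \<open>g\<close> on these finitely many points
  therefore settles the condition for \<open>g\<close>.\<close>

lemma Aut_closed:
  assumes "bij g" and approx: "\<And>F. finite F \<Longrightarrow> \<exists>h\<in>Aut M. \<forall>x\<in>F. h x = g x"
  shows "g \<in> Aut M"
proof -
  have "g (finterp M f xs) = finterp M f (map g xs)" if "f \<in> fsyms M" "length xs = farity M f" for f xs
  proof -
    obtain h where "h \<in> Aut M" "\<forall>x\<in>insert (finterp M f xs) (set xs). h x = g x"
      using approx[of "insert (finterp M f xs) (set xs)"] by auto
    moreover then have "map h xs = map g xs" by auto
    ultimately show ?thesis using that by (auto simp: Aut_def)
  qed
  moreover have "map g xs \<in> rinterp M r \<longleftrightarrow> xs \<in> rinterp M r"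
    if "r \<in> rsyms M" "length xs = rarity M r" for r xs
  proof -
    obtain h where "h \<in> Aut M" "\<forall>x\<in>set xs. h x = g x"
      using approx[of "set xs"] by auto
    moreover then have "map h xs = map g xs" by auto
    ultimately show ?thesis using that unfolding Aut_def by (metis (mono_tags, lifting) mem_Collect_eq)
  qed
  ultimately show ?thesis using \<open>bij g\<close> by (auto simp: Aut_def)
qed

text \<open>The bound on the free variables keeps \<open>(!) xs\<close> from being read past the end
  of the list, where its values are unspecified.\<close>

definition type_of :: "('f, 'r, 'a) fo_structure \<Rightarrow> 'a list \<Rightarrow> ('f, 'r) fo_form set" where
  "type_of M xs = {\<phi>. wf_form M \<phi> \<and> fv_form \<phi> \<subseteq> {..<length xs} \<and> sat M ((!) xs) \<phi>}"

lemma type_of_map_Aut: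
  assumes "g \<in> Aut M"
  shows "type_of M (map g xs) = type_of M xs"
proof -
  have "sat M ((!) (map g xs)) \<phi> \<longleftrightarrow> sat M ((!) xs) \<phi>"
    if "wf_form M \<phi>" "fv_form \<phi> \<subseteq> {..<length xs}" for \<phi>
  proof -
    have "sat M ((!) (map g xs)) \<phi> \<longleftrightarrow> sat M (\<lambda>i. g (xs ! i)) \<phi>"
      using that(2) by (intro sat_cong) auto
    then show ?thesis using sat_Aut[OF assms that(1)] by simp
  qed
  then show ?thesis by (auto simp: type_of_def)
qed

definition agree :: "('f, 'r, 'a) fo_structure \<Rightarrow> 'a list \<Rightarrow> 'a list \<Rightarrow> bool" where
  "agree M xs ys \<longleftrightarrow> length xs = length ys \<and> type_of M xs = type_of M ys"

lemma agree_sat: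
  assumes "agree M xs ys" "wf_form M \<phi>" "fv_form \<phi> \<subseteq> {..<length xs}"
  shows "sat M ((!) xs) \<phi> \<longleftrightarrow> sat M ((!) ys) \<phi>"
  using assms unfolding agree_def type_of_def by auto

section \<open>Types in structures with finitely many orbits on tuples\<close>

lemma separate_types:
  assumes "length ys = length xs" "type_of M ys \<noteq> type_of M xs"
  shows "\<exists>\<phi>\<in>type_of M xs. \<phi> \<notin> type_of M ys"
proof (cases "type_of M xs \<subseteq> type_of M ys")
  case True
  \<comment> \<open>Types are complete: a formula that lies only in the other type separates through
    its negation.\<close>
  then obtain \<phi> where "\<phi> \<in> type_of M ys" "\<phi> \<notin> type_of M xs" using assms(2) by auto
  then show ?thesis
    using assms(1) by (intro bexI[of _ "Neg \<phi>"]) (auto simp: type_of_def)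
qed auto

text \<open>The second assumption says that there are finitely many orbits on
  \<open>n\<close>-tuples: every orbit has a representative with entries in the finite set
  \<open>W\<close>. In this form it follows directly from linear algebra.\<close>

locale oligomorphic =
  fixes M :: "('f, 'r, 'a) fo_structure"
  assumes countable_carrier: "countable (UNIV :: 'a set)"
    and finite_orbits: "\<And>n. \<exists>W. finite W \<and> (\<forall>xs. length xs = n \<longrightarrow> (\<exists>g\<in>Aut M. g ` set xs \<subseteq> W))"
begin

lemma finite_types: "finite (type_of M ` {xs. length xs = n})"
proof -
  obtain W where W: "finite W" "\<forall>xs. length xs = n \<longrightarrow> (\<exists>g\<in>Aut M. g ` set xs \<subseteq> W)"
    using finite_orbits[of n] by (elim exE conjE)
  have "type_of M ` {xs. length xs = n} \<subseteq> type_of M ` {xs. set xs \<subseteq> W \<and> length xs = n}"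
  proof clarify
    fix xs :: "'a list" assume "n = length xs"
    then obtain g where "g \<in> Aut M" "g ` set xs \<subseteq> W" using W by auto
    then show "type_of M xs \<in> type_of M ` {ys. set ys \<subseteq> W \<and> length ys = length xs}"
      using type_of_map_Aut[of g M xs] by (intro image_eqI[of _ _ "map g xs"]) auto
  qed
  then show ?thesis
    by (rule finite_surj[rotated]) (rule finite_lists_length_eq[OF W(1)])
qed

text \<open>Only finitely many other types of this length exist. Each is excluded by one formula in
  the type of \<open>xs\<close>, and the conjunction of these formulas isolates the type.\<close>

lemma isolating_formula:
  "\<exists>\<phi>\<in>type_of M xs. \<forall>ys. length ys = length xs \<and> \<phi> \<in> type_of M ys \<longrightarrow> type_of M ys = type_of M xs"
proof -
  let ?T = "type_of M ` {ys. length ys = length xs} - {type_of M xs}"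
  have "\<exists>\<phi>\<in>type_of M xs. \<forall>ys. length ys = length xs \<and> type_of M ys \<in> T \<longrightarrow> \<phi> \<notin> type_of M ys"
    if "finite T" "T \<subseteq> ?T" for T
    using that
  proof (induction T rule: finite_induct)
    case empty
    then show ?case
      \<comment> \<open>A true sentence stands for the empty conjunction; having no free variables,
        it is allowed even when \<open>xs\<close> is empty.\<close>
      by (intro bexI[of _ "Ex 0 (Eq (Var 0) (Var 0))"]) (auto simp: type_of_def)
  next
    case (insert t T)
    then obtain \<phi> where \<phi>: "\<phi> \<in> type_of M xs"
      "\<forall>ys. length ys = length xs \<and> type_of M ys \<in> T \<longrightarrow> \<phi> \<notin> type_of M ys" by auto
    from insert.prems obtain \<psi> where \<psi>: "\<psi> \<in> type_of M xs" "\<psi> \<notin> t"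
      using separate_types[of _ xs M] by auto
    have conj: "Conj \<phi> \<psi> \<in> type_of M ys \<longleftrightarrow> \<phi> \<in> type_of M ys \<and> \<psi> \<in> type_of M ys" for ys
      unfolding type_of_def by auto
    show ?case
    proof (intro bexI[of _ "Conj \<phi> \<psi>"] allI impI)
      fix ys assume "length ys = length xs \<and> type_of M ys \<in> insert t T"
      then show "Conj \<phi> \<psi> \<notin> type_of M ys" using \<phi>(2) \<psi>(2) conj by blast
    qed (use \<phi>(1) \<psi>(1) conj in blast)
  qed
  from this[OF finite_Diff[OF finite_types] subset_refl]
  obtain \<phi> where \<phi>: "\<phi> \<in> type_of M xs"
    "\<And>ys. length ys = length xs \<Longrightarrow> type_of M ys \<in> ?T \<Longrightarrow> \<phi> \<notin> type_of M ys"
    by blast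
  show ?thesis
    by (rule bexI[OF _ \<phi>(1)]) (use \<phi>(2) in blast)
qed

text \<open>If \<open>\<phi>\<close> isolates the type of \<open>xs @ [a]\<close>, then
  \<open>Ex ?n \<phi>\<close> holds of \<open>xs\<close>, hence of \<open>ys\<close>, and any
  witness for \<open>ys\<close> realizes the same type.\<close>

lemma agree_extend:
  assumes "agree M xs ys"
  shows "\<exists>b. agree M (xs @ [a]) (ys @ [b])"
proof -
  let ?n = "length xs"
  have len: "length ys = ?n" using assms by (simp add: agree_def)
  obtain \<phi> where \<phi>: "\<phi> \<in> type_of M (xs @ [a])"
    "\<And>zs. length zs = Suc ?n \<Longrightarrow> \<phi> \<in> type_of M zs \<Longrightarrow> type_of M zs = type_of M (xs @ [a])"
    using isolating_formula[of "xs @ [a]"] by auto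
  have wf: "wf_form M \<phi>" and fv: "fv_form \<phi> \<subseteq> {..<Suc ?n}"
    using \<phi>(1) by (auto simp: type_of_def)
  then have fv': "fv_form \<phi> - {?n} \<subseteq> {..<?n}" by (auto simp: less_Suc_eq)
  have ext: "sat M ((!) (zs @ [b])) \<phi> \<longleftrightarrow> sat M (((!) zs)(?n := b)) \<phi>" if "length zs = ?n" for zs b
    using fv that by (intro sat_cong) (auto simp: nth_append)
  have "sat M ((!) xs) (Ex ?n \<phi>)"
    using \<phi>(1) ext[of xs a] by (auto simp: type_of_def)
  then have "sat M ((!) ys) (Ex ?n \<phi>)"
    using agree_sat[OF assms, of "Ex ?n \<phi>"] wf fv' by simp
  then obtain b where "sat M ((!) (ys @ [b])) \<phi>"
    using ext[OF len] by auto
  then have "\<phi> \<in> type_of M (ys @ [b])"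
    using wf fv len by (auto simp: type_of_def)
  then show ?thesis
    using \<phi>(2)[of "ys @ [b]"] len by (auto simp: agree_def)
qed

lemma agree_extend_both:
  assumes "agree M xs ys"
  shows "\<exists>a' b'. agree M (xs @ [a, a']) (ys @ [b', a])"
proof -
  obtain b' where "agree M (xs @ [a]) (ys @ [b'])" using agree_extend[OF assms] by blast
  then have "agree M (ys @ [b']) (xs @ [a])" by (simp add: agree_def)
  then obtain a' where "agree M ((ys @ [b']) @ [a]) ((xs @ [a]) @ [a'])"
    using agree_extend by blast
  then show ?thesis by (auto simp: agree_def)
qed

text \<open>The result is a pair of enumerations of the carrier, possibly with repetitions, rather
  than a map. Formulas can then be evaluated directly at \<open>P\<close> and
  \<open>Q\<close>.\<close>

lemma back_and_forth:
  assumes "agree M xs ys"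
  shows "\<exists>P Q. range P = UNIV \<and> range Q = UNIV \<and>
    (\<forall>i<length xs. P i = xs ! i \<and> Q i = ys ! i) \<and>
    (\<forall>\<phi>. wf_form M \<phi> \<longrightarrow> (sat M P \<phi> \<longleftrightarrow> sat M Q \<phi>))"
proof -
  let ?ag = "\<lambda>l. agree M (map fst l) (map snd l)"
  let ?a = "from_nat_into (UNIV :: 'a set)"
  \<comment> \<open>Stage \<open>n\<close> puts the \<open>n\<close>-th element of the carrier on
    both sides, each time opposite a suitable partner, so that both enumerations become
    surjective.\<close>
  let ?step = "\<lambda>n l l'. \<exists>a' b'. l' = l @ [(?a n, b'), (a', ?a n)]"
  have "\<exists>s. (?ag (s 0) \<and> s 0 = zip xs ys) \<and> (\<forall>n. (?ag (s (Suc n)) \<and> True) \<and> ?step n (s n) (s (Suc n)))"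
  proof -
    have start: "?ag (zip xs ys)" using assms by (simp add: agree_def)
    have step: "\<exists>l'. ?ag l' \<and> ?step n l l'" if l: "?ag l" for n l
    proof -
      obtain a' b' where "agree M (map fst l @ [?a n, a']) (map snd l @ [b', ?a n])"
        using agree_extend_both[OF l] by blast
      then show ?thesis by (intro exI[of _ "l @ [(?a n, b'), (a', ?a n)]"]) auto
    qed
    have "\<exists>s. \<forall>n. (?ag (s n) \<and> (n = 0 \<longrightarrow> s n = zip xs ys)) \<and> ?step n (s n) (s (Suc n))"
      by (rule dependent_nat_choice) (use start step in auto)
    then show ?thesis by blast
  qed
  then obtain s where s0: "s 0 = zip xs ys" and ag: "?ag (s n)" and step: "?step n (s n) (s (Suc n))" for n
    by (metis not0_implies_Suc)
  have len: "length (s n) = length xs + 2 * n" for n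
  proof (induction n)
    case 0
    then show ?case using s0 assms by (simp add: agree_def)
  next
    case (Suc n)
    then show ?case using step[of n] by auto
  qed
  \<comment> \<open>The lists extend one another and \<open>s (Suc i)\<close> has more than
    \<open>i\<close> entries, so \<open>Z\<close> is their limit.\<close>
  define Z where "Z i = s (Suc i) ! i" for i
  have mono: "i < length (s m) \<Longrightarrow> m \<le> n \<Longrightarrow> s n ! i = s m ! i" for i m n
  proof (induction n rule: nat_induct)
    case (Suc n)
    show ?case
    proof (cases "m = Suc n")
      case False
      then have "s n ! i = s m ! i" using Suc by auto
      moreover have "i < length (s n)" using Suc.prems False len[of m] len[of n] by auto
      ultimately show ?thesis using step[of n] by (auto simp: nth_append)
    qed auto
  qed auto
  have Z: "s n ! i = Z i" if "i < length (s n)" for n i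
  proof (cases "n \<le> Suc i")
    case True
    then show ?thesis using mono[of i n "Suc i"] that by (simp add: Z_def)
  next
    case False
    then show ?thesis using mono[of i "Suc i" n] len[of "Suc i"] by (simp add: Z_def)
  qed
  have in_Z: "z \<in> range Z" if "z \<in> set (s n)" for n z
    using that Z[of _ n] by (metis in_set_conv_nth rangeI)
  have hit: "\<exists>a' b'. (?a n, b') \<in> range Z \<and> (a', ?a n) \<in> range Z" for n
  proof -
    obtain a' b' where "s (Suc n) = s n @ [(?a n, b'), (a', ?a n)]" using step[of n] by auto
    then have "(?a n, b') \<in> set (s (Suc n))" "(a', ?a n) \<in> set (s (Suc n))" by simp_all
    then show ?thesis using in_Z by blast
  qed
  have surj: "\<exists>n. ?a n = x" for x
    using from_nat_into_surj[OF countable_carrier] by auto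
  have "range (fst \<circ> Z) = UNIV" "range (snd \<circ> Z) = UNIV"
  proof -
    have "x \<in> fst ` range Z" "x \<in> snd ` range Z" for x
      using surj[of x] hit by (metis fst_conv image_eqI, metis snd_conv image_eqI)
    then show "range (fst \<circ> Z) = UNIV" "range (snd \<circ> Z) = UNIV" by (auto simp: image_comp)
  qed
  moreover have "\<forall>i<length xs. (fst \<circ> Z) i = xs ! i \<and> (snd \<circ> Z) i = ys ! i"
    using Z[of _ 0] s0 assms by (auto simp: agree_def) (metis fst_conv nth_zip, metis snd_conv nth_zip)
  moreover have "sat M (fst \<circ> Z) \<phi> \<longleftrightarrow> sat M (snd \<circ> Z) \<phi>" if "wf_form M \<phi>" for \<phi>
  proof -
    \<comment> \<open>Only finitely many variables matter, so truth along the limit is decided at a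
      finite stage.\<close>
    obtain n where n: "fv_form \<phi> \<subseteq> {..<n}"
      using finite_fv_form[of \<phi>] finite_nat_iff_bounded by auto
    have less: "i < length (s n)" if "i \<in> fv_form \<phi>" for i using that n len[of n] by auto
    have "sat M (fst \<circ> Z) \<phi> \<longleftrightarrow> sat M ((!) (map fst (s n))) \<phi>"
      by (intro sat_cong) (simp add: less Z)
    also have "\<dots> \<longleftrightarrow> sat M ((!) (map snd (s n))) \<phi>"
      using less by (intro agree_sat ag that) auto
    also have "\<dots> \<longleftrightarrow> sat M (snd \<circ> Z) \<phi>"
      by (intro sat_cong) (simp add: less Z)
    finally show ?thesis .
  qed
  ultimately show ?thesis by blast
qed

text \<open>Sending \<open>P i\<close> to \<open>Q i\<close> is well defined and injective because
  \<open>P i = P j\<close> is expressed by a formula. Atomic formulas in variables show in the same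
  way that this map respects operations and relations.\<close>

lemma agree_imp_orbit:
  assumes "agree M xs ys"
  shows "\<exists>g\<in>Aut M. map g xs = ys"
proof -
  obtain P Q where PQ: "range P = UNIV" "range Q = UNIV"
    "\<And>i. i < length xs \<Longrightarrow> P i = xs ! i \<and> Q i = ys ! i"
    "\<And>\<phi>. wf_form M \<phi> \<Longrightarrow> sat M P \<phi> \<longleftrightarrow> sat M Q \<phi>"
    using back_and_forth[OF assms] by metis
  have eq: "P i = P j \<longleftrightarrow> Q i = Q j" for i j
    using PQ(4)[of "Eq (Var i) (Var j)"] by simp
  define g where "g = Q \<circ> inv P"
  have PinvP: "P (inv P x) = x" for x using PQ(1) by (simp add: surj_f_inv_f)
  have gP: "g (P i) = Q i" for i
    using eq[of "inv P (P i)" i] PinvP by (simp add: g_def)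
  have bij: "bij g"
  proof (rule bijI)
    show "inj g" by (rule injI) (metis PinvP gP eq)
    show "surj g" using PQ(2) gP by (metis UNIV_eq_I rangeE rangeI)
  qed
  have Pmap: "\<exists>is. zs = map P is" for zs
    using PinvP by (intro exI[of _ "map (inv P) zs"]) (simp add: comp_def)
  have "g (finterp M f zs) = finterp M f (map g zs)" if "f \<in> fsyms M" "length zs = farity M f" for f zs
  proof -
    obtain "is" j where "zs = map P is" "finterp M f zs = P j" using Pmap PinvP by metis
    moreover then have "Q j = finterp M f (map Q is)"
      using that PQ(4)[of "Eq (Var j) (App f (map Var is))"] by (auto simp: list_all_iff comp_def)
    ultimately show ?thesis by (simp add: gP comp_def)
  qed
  moreover have "map g zs \<in> rinterp M r \<longleftrightarrow> zs \<in> rinterp M r"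
    if "r \<in> rsyms M" "length zs = rarity M r" for r zs
  proof -
    obtain "is" where "zs = map P is" using Pmap by metis
    then show ?thesis
      using that PQ(4)[of "Rel r (map Var is)"] by (auto simp: list_all_iff comp_def gP)
  qed
  ultimately have "g \<in> Aut M" using bij by (auto simp: Aut_def)
  moreover have "map g xs = ys"
    using assms PQ(3) gP by (auto simp: agree_def intro!: nth_equalityI) metis
  ultimately show ?thesis by auto
qed

text \<open>By \<open>agree_imp_orbit\<close> an invariant set contains every tuple of the same type
  as one of its members. It is thus cut out by finitely many types, and the disjunction of their
  isolating formulas defines it.\<close>

lemma definable_if_invariant:
  assumes len: "\<And>xs. xs \<in> X \<Longrightarrow> length xs = n"
    and inv: "\<And>g xs. g \<in> Aut M \<Longrightarrow> xs \<in> X \<Longrightarrow> map g xs \<in> X"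
  shows "definable_relation M n X"
proof -
  have "\<exists>\<phi>. wf_form M \<phi> \<and> fv_form \<phi> \<subseteq> {..<n} \<and>
      (\<forall>xs. length xs = n \<longrightarrow> (sat M ((!) xs) \<phi> \<longleftrightarrow> type_of M xs \<in> T))"
    if "finite T" "T \<subseteq> type_of M ` X" for T
    using that
  proof (induction T rule: finite_induct)
    case empty
    then show ?case
      by (intro exI[of _ "Neg (Ex 0 (Eq (Var 0) (Var 0)))"]) auto
  next
    case (insert t T)
    then obtain \<phi> where \<phi>: "wf_form M \<phi>" "fv_form \<phi> \<subseteq> {..<n}"
      "\<And>xs. length xs = n \<Longrightarrow> sat M ((!) xs) \<phi> \<longleftrightarrow> type_of M xs \<in> T" by auto
    from insert.prems obtain ys where ys: "t = type_of M ys" "length ys = n" using len by auto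
    obtain \<psi> where \<psi>: "\<psi> \<in> t" "\<And>xs. length xs = n \<Longrightarrow> \<psi> \<in> type_of M xs \<Longrightarrow> type_of M xs = t"
      using isolating_formula[of ys] ys by auto
    have "wf_form M \<psi>" "fv_form \<psi> \<subseteq> {..<n}" using \<psi>(1) ys by (auto simp: type_of_def)
    moreover then have "sat M ((!) xs) \<psi> \<longleftrightarrow> type_of M xs = t" if "length xs = n" for xs
      using \<psi> that by (auto simp: type_of_def)
    ultimately show ?case
      using \<phi> by (intro exI[of _ "Neg (Conj (Neg \<phi>) (Neg \<psi>))"]) auto
  qed
  moreover have "finite (type_of M ` X)"
    using finite_subset[OF image_mono finite_types, of X n] len by auto
  ultimately obtain \<phi> where \<phi>: "wf_form M \<phi>" "fv_form \<phi> \<subseteq> {..<n}"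
      "\<And>xs. length xs = n \<Longrightarrow> sat M ((!) xs) \<phi> \<longleftrightarrow> type_of M xs \<in> type_of M ` X"
    by blast
  have mem: "type_of M xs \<in> type_of M ` X \<longleftrightarrow> xs \<in> X" if xs: "length xs = n" for xs
  proof
    assume "type_of M xs \<in> type_of M ` X"
    then obtain ys where ys: "ys \<in> X" "type_of M ys = type_of M xs" by auto
    then have "agree M ys xs" using len xs by (simp add: agree_def)
    then show "xs \<in> X" using agree_imp_orbit inv ys(1) by blast
  qed auto
  have "sat M e \<phi> \<longleftrightarrow> map e [0..<n] \<in> X" for e
  proof -
    have "sat M e \<phi> \<longleftrightarrow> sat M ((!) (map e [0..<n])) \<phi>"
      using \<phi>(2) by (intro sat_cong) auto
    then show ?thesis using \<phi>(3) mem by simp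
  qed
  moreover have "\<exists>e. xs = map e [0..<n]" if "xs \<in> X" for xs
    using len[OF that] map_nth[of xs] by metis
  ultimately have "X = {map e [0..<n] | e. sat M e \<phi>}" by auto
  then show ?thesis using \<phi> by (auto simp: definable_relation_def)
qed

end

lemma definable_imp_invariant:
  assumes "definable_relation M n X" "g \<in> Aut M" "xs \<in> X"
  shows "map g xs \<in> X"
proof -
  obtain \<phi> where \<phi>: "wf_form M \<phi>" "X = {map e [0..<n] | e. sat M e \<phi>}"
    using assms(1) by (auto simp: definable_relation_def)
  then obtain e where e: "xs = map e [0..<n]" "sat M e \<phi>" using assms(3) by auto
  have "map g xs = map (\<lambda>i. g (e i)) [0..<n]" using e by simp
  moreover have "sat M (\<lambda>i. g (e i)) \<phi>" using sat_Aut[OF assms(2) \<phi>(1)] e by simp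
  ultimately show ?thesis using \<phi>(2) by blast
qed

lemma basic_relation_length:
  assumes "(n, X) \<in> basic_relations R" "xs \<in> X"
  shows "length xs = n"
  using assms by (auto simp: basic_relations_def)

lemma basic_relation_invariant:
  assumes "(n, X) \<in> basic_relations R" "g \<in> Aut R" "xs \<in> X"
  shows "map g xs \<in> X"
  using assms unfolding basic_relations_def Aut_def by auto

text \<open>Invariance gives one implication for a relation; the converse comes from
  \<open>inv g\<close>. For an operation one implication suffices, since in its graph the arguments
  determine the value.\<close>

lemma Aut_antimono_fo_reduct:
  assumes "fo_reduct R M"
  shows "Aut M \<subseteq> Aut R"
proof
  fix g assume g: "g \<in> Aut M"
  then have inv: "inv g \<in> Aut M" by (rule Aut_inv)
  have bij: "bij g" using g by (simp add: Aut_def)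
  have invmap: "map (inv g) (map g xs) = xs" for xs
    using bij by (simp add: bij_is_inj comp_def)
  have defn: "definable_relation M n X" if "(n, X) \<in> basic_relations R" for n X
    using assms that by (auto simp: fo_reduct_def)
  have "g (finterp R f xs) = finterp R f (map g xs)" if "f \<in> fsyms R" "length xs = farity R f" for f xs
  proof -
    let ?X = "{xs @ [finterp R f xs] | xs. length xs = farity R f}"
    have "(Suc (farity R f), ?X) \<in> basic_relations R" using that(1) by (auto simp: basic_relations_def)
    from definable_imp_invariant[OF defn[OF this] g, of "xs @ [finterp R f xs]"]
    show ?thesis using that(2) by auto
  qed
  moreover have "map g xs \<in> rinterp R r \<longleftrightarrow> xs \<in> rinterp R r"
    if "r \<in> rsyms R" "length xs = rarity R r" for r xs
  proof -
    let ?X = "{xs \<in> rinterp R r. length xs = rarity R r}"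
    have X: "(rarity R r, ?X) \<in> basic_relations R" using that(1) by (auto simp: basic_relations_def)
    show ?thesis
      using definable_imp_invariant[OF defn[OF X] g, of xs]
        definable_imp_invariant[OF defn[OF X] inv, of "map g xs"] that(2) invmap[of xs]
      by (auto simp del: map_map)
  qed
  ultimately show "g \<in> Aut R" using bij by (auto simp: Aut_def)
qed

lemma (in oligomorphic) fo_reduct_iff: "fo_reduct R M \<longleftrightarrow> Aut M \<subseteq> Aut R"
proof
  assume sub: "Aut M \<subseteq> Aut R"
  show "fo_reduct R M"
    unfolding fo_reduct_def
  proof clarify
    fix n X assume "(n, X) \<in> basic_relations R"
    then show "definable_relation M n X"
      by (intro definable_if_invariant) (use basic_relation_length basic_relation_invariant sub in blast)+
  qed
qed (rule Aut_antimono_fo_reduct)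

section \<open>Linear algebra over the two-element field\<close>

context F2_omega
begin

sublocale endo: vector_space_pair scale scale ..

lemma add_self [simp]: "x + x = (0::'v)"
proof -
  have "x + x = scale (1 + 1) x" by (simp only: scale_left_distrib scale_one)
  then show ?thesis by simp
qed

lemma add_self_left [simp]: "x + (x + y) = (y::'v)"
  by (simp flip: add.assoc)

lemma add_eq_zero_iff [simp]: "x + y = 0 \<longleftrightarrow> x = (y::'v)"
  by (metis add.right_neutral add_self_left)

lemma minus_eq [simp]: "- x = (x::'v)"
  by (metis add_self minus_unique)

lemma diff_eq [simp]: "x - y = x + (y::'v)"
  by (metis diff_conv_add_uminus minus_eq)

text \<open>The only scalars are 0 and 1, so homogeneity reduces to \<open>g 0 = 0\<close>.\<close>

lemma linear_iff_additive:
  "Vector_Spaces.linear scale scale g \<longleftrightarrow> (\<forall>x y. g (x + y) = g x + g y)"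
proof
  assume add: "\<forall>x y. g (x + y) = g x + g y"
  have "g 0 + g 0 = g 0" using add by (metis add.right_neutral)
  then have "g 0 = 0" by simp
  then have "g (scale c x) = scale c (g x)" for c x by (cases c) auto
  then show "Vector_Spaces.linear scale scale g"
    using add vector_space_axioms by (simp add: Vector_Spaces.linear_iff)
qed (auto simp: endo.linear_add)

lemma GL_iff: "g \<in> GL scale \<longleftrightarrow> bij g \<and> (\<forall>x y. g (x + y) = g x + g y)"
  by (auto simp: GL_def Sym_def linear_iff_additive)

lemma GL_0: "g \<in> GL scale \<Longrightarrow> g 0 = 0"
  by (auto simp: GL_def endo.linear_0)

lemma GL_span_image: "g \<in> GL scale \<Longrightarrow> g ` span S = span (g ` S)"
  by (auto simp: GL_def endo.linear_span_image)

lemma GL_sum: "g \<in> GL scale \<Longrightarrow> g (sum h A) = (\<Sum>a\<in>A. g (h a))"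
  by (auto simp: GL_def endo.linear_sum)

lemma GL_eq_on_span:
  assumes "g \<in> GL scale" "\<And>x. x \<in> S \<Longrightarrow> g x = x" "x \<in> span S"
  shows "g x = x"
  using endo.linear_eq_on_span[of g id S x] assms linear_id by (auto simp: GL_def)

text \<open>Coefficients are 0 or 1, and adding \<open>x\<close> to a subset sum inserts
  \<open>x\<close> into the subset or, in characteristic two, removes it.\<close>

lemma span_eq_subset_sums: "span S = {\<Sum>C | C. finite C \<and> C \<subseteq> S}"
proof (intro equalityI subsetI)
  fix x assume "x \<in> span S"
  then show "x \<in> {\<Sum>C | C. finite C \<and> C \<subseteq> S}"
  proof (induction rule: span_induct_alt)
    case base
    have "\<Sum>{} = (0::'v)" by simp
    then show ?case by (smt (verit) empty_subsetI finite.emptyI mem_Collect_eq)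
  next
    case (step c x y)
    then obtain C where C: "finite C" "C \<subseteq> S" "y = \<Sum>C" by auto
    show ?case
    proof (cases "c = 0")
      case True
      then show ?thesis using C by auto
    next
      case False
      then have c: "c = 1" by simp
      show ?thesis
      proof (cases "x \<in> C")
        case True
        then have "y = x + \<Sum>(C - {x})" using C by (simp add: sum.remove)
        then have "scale c x + y = \<Sum>(C - {x})" by (simp add: c)
        moreover have "finite (C - {x})" "C - {x} \<subseteq> S" using C by auto
        ultimately show ?thesis by blast
      next
        case False
        then have "scale c x + y = \<Sum>(insert x C)" using C by (simp add: c)
        moreover have "finite (insert x C)" "insert x C \<subseteq> S" using C step by auto
        ultimately show ?thesis by blast
      qed
    qed
  qed
qed (auto intro: span_sum dest: span_base)

lemma span_sumE:
  assumes "x \<in> span S"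
  obtains C where "finite C" "C \<subseteq> S" "x = \<Sum>C"
  using assms unfolding span_eq_subset_sums by auto

lemma finite_span: "finite S \<Longrightarrow> finite (span S)"
  unfolding span_eq_subset_sums by (rule finite_subset[of _ "sum id ` Pow S"]) (auto simp: id_def)

lemma countable_UNIV: "countable (UNIV :: 'v set)"
proof -
  obtain B where B: "countable B" "span B = UNIV" using countably_infinite_basis by auto
  have "span B \<subseteq> sum id ` {C. finite C \<and> C \<subseteq> B}"
    unfolding span_eq_subset_sums by (auto simp: id_def)
  then show ?thesis
    using countable_Collect_finite_subset[OF B(1)] B(2) by (metis countable_image countable_subset)
qed

lemma infinite_UNIV: "infinite (UNIV :: 'v set)"
proof -
  obtain B :: "'v set" where "infinite B" using countably_infinite_basis by auto
  then show ?thesis using finite_subset[OF subset_UNIV] by blast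
qed

lemma exists_independent_extension:
  assumes "independent B" "finite B"
  obtains B' where "B \<subseteq> B'" "independent B'" "span B' = UNIV" "infinite (B' - B)"
proof -
  obtain B' where B': "B \<subseteq> B'" "independent B'" "UNIV \<subseteq> span B'"
    using maximal_independent_subset_extend[of B UNIV] assms by auto
  then have "infinite B'" using finite_span infinite_UNIV by (metis finite_subset)
  then show ?thesis using B' assms(2) by (intro that[of B']) auto
qed

text \<open>Both sets are completed to bases. What is added is countably infinite on either side, so
  \<open>h\<close> extends to a bijection of the bases; its linear extension is inverted by that of
  the inverse bijection.\<close>

lemma GL_extend:
  assumes "finite B" "independent B" "independent C" "bij_betw h B C"
  shows "\<exists>L\<in>GL scale. \<forall>b\<in>B. L b = h b"
proof -
  have "finite C" using assms by (metis bij_betw_finite)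
  obtain B' where B': "B \<subseteq> B'" "independent B'" "span B' = UNIV" "infinite (B' - B)"
    using exists_independent_extension assms by metis
  obtain C' where C': "C \<subseteq> C'" "independent C'" "span C' = UNIV" "infinite (C' - C)"
    using exists_independent_extension assms(3) \<open>finite C\<close> by metis
  have count: "countable A" for A :: "'v set"
    by (rule countable_subset[OF subset_UNIV countable_UNIV])
  obtain k where k: "bij_betw k (B' - B) (C' - C)"
    using bij_betw_trans[OF to_nat_on_infinite[OF count B'(4)] bij_betw_from_nat_into[OF count C'(4)]]
    by blast
  define p where "p b = (if b \<in> B then h b else k b)" for b
  have "bij_betw p B C" using assms(4) by (subst bij_betw_cong[of _ _ h]) (auto simp: p_def)
  moreover have "bij_betw p (B' - B) (C' - C)" using k by (subst bij_betw_cong[of _ _ k]) (auto simp: p_def)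
  ultimately have "bij_betw p (B \<union> (B' - B)) (C \<union> (C' - C))"
    by (rule bij_betw_combine) auto
  then have p: "bij_betw p B' C'" using B'(1) C'(1) by (simp add: Un_absorb1)
  then obtain q where q: "bij_betw q C' B'" "\<And>b. b \<in> B' \<Longrightarrow> q (p b) = b" "\<And>c. c \<in> C' \<Longrightarrow> p (q c) = c"
    by (metis bij_betw_inv_into bij_betw_inv_into_left bij_betw_inv_into_right)
  define L where "L = endo.construct B' p"
  define K where "K = endo.construct C' q"
  have lin: "Vector_Spaces.linear scale scale L" "Vector_Spaces.linear scale scale K"
    using B' C' by (simp_all add: L_def K_def endo.linear_construct)
  have L: "L b = p b" if "b \<in> B'" for b
    using that B' by (simp add: L_def endo.construct_basis)
  have K: "K c = q c" if "c \<in> C'" for c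
    using that C' by (simp add: K_def endo.construct_basis)
  have pB: "p b \<in> C'" if "b \<in> B'" for b using that p by (auto simp: bij_betw_def)
  have qC: "q c \<in> B'" if "c \<in> C'" for c using that q by (auto simp: bij_betw_def)
  have "(K \<circ> L) x = id x" for x
  proof (rule endo.linear_eq_on_span[where f = "K \<circ> L" and g = id and B = B'])
    show "Vector_Spaces.linear scale scale (K \<circ> L)" by (rule Vector_Spaces.linear_compose[OF lin])
    show "(K \<circ> L) b = id b" if "b \<in> B'" for b using that L K pB q(2) by simp
    show "x \<in> span B'" using B'(3) by simp
  qed (rule linear_id)
  moreover have "(L \<circ> K) x = id x" for x
  proof (rule endo.linear_eq_on_span[where f = "L \<circ> K" and g = id and B = C'])
    show "Vector_Spaces.linear scale scale (L \<circ> K)" by (rule Vector_Spaces.linear_compose[OF lin(2,1)])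
    show "(L \<circ> K) c = id c" if "c \<in> C'" for c using that L K qC q(3) by simp
    show "x \<in> span C'" using C'(3) by simp
  qed (rule linear_id)
  ultimately have "bij L"
    by (intro o_bij[of K]) auto
  then show ?thesis
    using lin(1) L subsetD[OF B'(1)] by (intro bexI[of _ L]) (auto simp: GL_def Sym_def p_def)
qed

lemma span_insert_eq: "span (insert a S) = span S \<union> (+) a ` span S"
proof (intro equalityI subsetI)
  fix x assume "x \<in> span (insert a S)"
  then obtain k where k: "x - scale k a \<in> span S" by (auto simp: span_insert)
  show "x \<in> span S \<union> (+) a ` span S"
  proof (cases "k = 0")
    case True
    then show ?thesis using k by simp
  next
    case False
    then have "a + x \<in> span S" using k by (simp add: add.commute)
    then show ?thesis by (intro UnI2 image_eqI[of _ _ "a + x"]) auto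
  qed
next
  fix x assume "x \<in> span S \<union> (+) a ` span S"
  then show "x \<in> span (insert a S)"
    using span_mono[OF subset_insertI, of S a] span_base[of a "insert a S"]
    by (auto intro!: span_add)
qed

lemma span_single: "span {x} = {0, x}"
  by (auto simp: span_insert_eq)

lemma span_pair: "span {x, y} = {0, x, y, x + y}"
  by (auto simp: span_insert_eq)

lemma independent_pair: "x \<noteq> 0 \<Longrightarrow> y \<noteq> 0 \<Longrightarrow> x \<noteq> y \<Longrightarrow> independent {x, y}"
  by (intro independent_insertI independent_empty) (auto simp: span_single)

lemma GL_transitive:
  assumes "a \<noteq> 0" "b \<noteq> 0"
  obtains L where "L \<in> GL scale" "L a = b"
  using GL_extend[of "{a}" "{b}" "\<lambda>_. b"] assms by (auto simp: bij_betw_def)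

text \<open>A maximal independent subset of an \<open>n\<close>-tuple can be carried into a fixed
  independent set of size \<open>n\<close>, and the whole tuple then lands in the finite span of
  that set.\<close>

lemma finite_GL_orbits:
  "\<exists>W. finite W \<and> (\<forall>xs. length xs = n \<longrightarrow> (\<exists>g\<in>GL scale. g ` set xs \<subseteq> W))"
proof -
  obtain B where B: "infinite B" "independent B" using countably_infinite_basis by auto
  obtain B\<^sub>n where Bn: "B\<^sub>n \<subseteq> B" "card B\<^sub>n = n" "finite B\<^sub>n"
    using infinite_arbitrarily_large[OF B(1)] by metis
  have "\<exists>g\<in>GL scale. g ` set xs \<subseteq> span B\<^sub>n" if len: "length xs = n" for xs
  proof -
    obtain C where C: "C \<subseteq> set xs" "independent C" "set xs \<subseteq> span C"
      using maximal_independent_subset by metis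
    then have fin: "finite C" by (auto intro: finite_subset)
    have "card C \<le> n" using C(1) len by (metis card_length card_mono le_trans List.finite_set)
    then obtain D where D: "D \<subseteq> B\<^sub>n" "card D = card C"
      using Bn by (metis obtain_subset_with_card_n)
    then have "finite D" using Bn by (metis finite_subset)
    then obtain h where h: "bij_betw h C D" using fin D(2) by (metis finite_same_card_bij)
    have "independent D" using B(2) D(1) Bn(1) independent_mono by (metis subset_trans)
    then obtain L where L: "L \<in> GL scale" "\<And>c. c \<in> C \<Longrightarrow> L c = h c"
      using GL_extend fin C(2) h by metis
    have "L ` set xs \<subseteq> span (L ` C)"
      using C(3) GL_span_image[OF L(1)] by blast
    also have "L ` C = D" using h L(2) by (auto simp: bij_betw_def)
    finally show ?thesis using L(1) span_mono[OF D(1)] by blast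
  qed
  then show ?thesis using finite_span[OF Bn(3)] by blast
qed

text \<open>As \<open>f\<close> and the shift by \<open>c\<close> are injective, each condition
  excludes only finitely many \<open>d\<close>. The shifted condition serves to make
  \<open>f d\<close> and \<open>f (c + d)\<close> generic at the same time.\<close>

lemma exists_avoiding:
  fixes f :: "'v \<Rightarrow> 'v"
  assumes "inj f" "finite A" "finite B"
  shows "\<exists>d. d \<notin> A \<and> f d \<notin> B \<and> f (c + d) \<notin> B"
proof -
  have "inj ((+) c)" by simp
  then have "finite (A \<union> f -` B \<union> (+) c -` (f -` B))"
    using assms by (intro finite_UnI finite_vimageI)
  then obtain d where "d \<notin> A \<union> f -` B \<union> (+) c -` (f -` B)"
    using ex_new_if_finite[OF infinite_UNIV] by metis
  then show ?thesis by auto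
qed

text \<open>Vectors are added one by one, each outside the span of all earlier ones and with its
  image outside the span of all earlier images. The two clauses range over subsets of
  \<open>P\<close> separately, because a set and its image under \<open>f\<close> need not be
  independent together.\<close>

lemma exists_generic:
  fixes f :: "'v \<Rightarrow> 'v"
  assumes "inj f" "finite P"
  shows "\<exists>E. finite E \<and> card E = m \<and> E \<inter> P = {} \<and>
    (\<forall>T\<subseteq>P. independent T \<longrightarrow> independent (T \<union> E)) \<and>
    (\<forall>T\<subseteq>P. independent (f ` T) \<longrightarrow> independent (f ` (T \<union> E)))"
proof (induction m)
  case 0
  then show ?case by (intro exI[of _ "{}"]) auto
next
  case (Suc m)
  then obtain E where E: "finite E" "card E = m" "E \<inter> P = {}"
    "\<And>T. T \<subseteq> P \<Longrightarrow> independent T \<Longrightarrow> independent (T \<union> E)"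
    "\<And>T. T \<subseteq> P \<Longrightarrow> independent (f ` T) \<Longrightarrow> independent (f ` (T \<union> E))"
    by blast
  obtain d where d: "d \<notin> span (P \<union> E)" "f d \<notin> span (f ` (P \<union> E))"
    using exists_avoiding[OF assms(1) finite_span finite_span, of "P \<union> E" "f ` (P \<union> E)"] assms(2) E(1)
    by auto
  have "d \<notin> P \<union> E" using d(1) span_base by blast
  moreover have "independent (T \<union> insert d E)" if "T \<subseteq> P" "independent T" for T
  proof -
    have "d \<notin> span (T \<union> E)" using d(1) span_mono[of "T \<union> E" "P \<union> E"] that(1) by blast
    then show ?thesis using E(4)[OF that] by (simp add: independent_insertI)
  qed
  moreover have "independent (f ` (T \<union> insert d E))" if "T \<subseteq> P" "independent (f ` T)" for T
  proof -
    have "f d \<notin> span (f ` (T \<union> E))"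
      using d(2) span_mono[of "f ` (T \<union> E)" "f ` (P \<union> E)"] that(1) by blast
    then show ?thesis using E(5)[OF that] by (simp add: independent_insertI)
  qed
  ultimately show ?case using E by (intro exI[of _ "insert d E"]) auto
qed

end

section \<open>Closed groups fixing zero\<close>

text \<open>The last assumption is closedness among the permutations in the topology of pointwise
  convergence.\<close>

locale closed_supergroup = F2_omega scale
  for scale :: "bit \<Rightarrow> 'v::ab_group_add \<Rightarrow> 'v" +
  fixes G :: "('v \<Rightarrow> 'v) set"
  assumes GL_subset: "GL scale \<subseteq> G"
    and bij: "g \<in> G \<Longrightarrow> bij g"
    and comp: "g \<in> G \<Longrightarrow> h \<in> G \<Longrightarrow> g \<circ> h \<in> G"
    and inverse: "g \<in> G \<Longrightarrow> inv g \<in> G"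
    and closed: "bij g \<Longrightarrow> (\<And>F. finite F \<Longrightarrow> \<exists>h\<in>G. \<forall>x\<in>F. h x = g x) \<Longrightarrow> g \<in> G"
begin

lemma inv_apply [simp]: "g \<in> G \<Longrightarrow> inv g (g x) = x"
  using bij by (simp add: bij_is_inj)

lemma apply_inv [simp]: "g \<in> G \<Longrightarrow> g (inv g x) = x"
  using bij by (simp add: bij_is_surj surj_f_inv_f)

lemma eq_iff: "g \<in> G \<Longrightarrow> g x = g y \<longleftrightarrow> x = y"
  using bij by (metis bij_is_inj inj_eq)

text \<open>This makes the analysis of groups fixing \<open>0\<close> available for the stabilizer
  in an arbitrary closed group.\<close>

lemma closed_supergroup_stabilizer: "closed_supergroup scale {g \<in> G. g 0 = 0}"
proof unfold_locales
  show "GL scale \<subseteq> {g \<in> G. g 0 = 0}" using GL_subset GL_0 by auto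
  show "inv g \<in> {g \<in> G. g 0 = 0}" if "g \<in> {g \<in> G. g 0 = 0}" for g
    using that inverse inv_apply[of g 0] by simp
  show "g \<in> {g \<in> G. g 0 = 0}"
    if "bij g" and approx: "\<And>F. finite F \<Longrightarrow> \<exists>h\<in>{g \<in> G. g 0 = 0}. \<forall>x\<in>F. h x = g x" for g
  proof -
    have "g \<in> G"
    proof (rule closed[OF \<open>bij g\<close>])
      show "\<exists>h\<in>G. \<forall>x\<in>F. h x = g x" if "finite F" for F
        using approx[OF that] by auto
    qed
    moreover have "g 0 = 0" using approx[of "{0}"] by auto
    ultimately show ?thesis by simp
  qed
qed (auto simp: bij comp)

text \<open>Finite independent sets of equal size are interchangeable under \<open>GL\<close>, so
  finite sets with this property can be moved as freely as independent ones.\<close>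

definition free_image :: "'v set \<Rightarrow> bool" where
  "free_image S \<longleftrightarrow> (\<exists>g\<in>G. independent (g ` S))"

lemma free_imageI: "g \<in> G \<Longrightarrow> independent (g ` S) \<Longrightarrow> free_image S"
  by (auto simp: free_image_def)

lemma free_image_independent: "independent S \<Longrightarrow> free_image S"
proof (rule free_imageI)
  show "id \<in> G" using GL_subset by (auto simp: GL_iff)
qed simp

lemma free_image_image:
  assumes "g \<in> G" "free_image (g ` S)"
  shows "free_image S"
proof -
  obtain h where "h \<in> G" "independent (h ` g ` S)" using assms(2) by (auto simp: free_image_def)
  then show ?thesis using comp[OF _ assms(1)] by (intro free_imageI[of "h \<circ> g"]) (auto simp: image_comp)
qed

text \<open>
  Fix \<open>C\<close> and move the vectors of \<open>B - C\<close> by a linear map to positions that are generic for a map in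
  \<open>G\<close> which makes \<open>insert (\<Sum>C) C\<close> independent.
\<close>

lemma free_image_insert_sum:
  assumes "finite B" "independent B" "C \<subseteq> B" "free_image (insert (\<Sum>C) C)"
  shows "free_image (insert (\<Sum>C) B)"
proof -
  define w where "w = \<Sum>C"
  have "finite C" using assms by (metis finite_subset)
  obtain f where f: "f \<in> G" "independent (f ` insert w C)"
    using assms(4) by (auto simp: free_image_def w_def)
  obtain E where E: "finite E" "card E = card (B - C)" "E \<inter> insert w C = {}"
    "\<And>T. T \<subseteq> insert w C \<Longrightarrow> independent T \<Longrightarrow> independent (T \<union> E)"
    "\<And>T. T \<subseteq> insert w C \<Longrightarrow> independent (f ` T) \<Longrightarrow> independent (f ` (T \<union> E))"
    using exists_generic[of f "insert w C" "card (B - C)"] bij[OF f(1)] \<open>finite C\<close>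
    by (auto dest: bij_is_inj)
  obtain k where k: "bij_betw k (B - C) E"
    using finite_same_card_bij[of "B - C" E] assms(1) E by auto
  define h where "h b = (if b \<in> C then b else k b)" for b
  have "bij_betw h C C" using bij_betw_id[of C] by (subst bij_betw_cong[of _ _ id]) (auto simp: h_def)
  moreover have "bij_betw h (B - C) E" using k by (subst bij_betw_cong[of _ _ k]) (auto simp: h_def)
  ultimately have "bij_betw h (C \<union> (B - C)) (C \<union> E)"
    by (rule bij_betw_combine) (use E(3) in auto)
  then have h: "bij_betw h B (C \<union> E)" using assms(3) by (simp add: Un_absorb1)
  have "independent (C \<union> E)" using E(4)[of C] assms independent_mono by blast
  then obtain L where L: "L \<in> GL scale" "\<And>b. b \<in> B \<Longrightarrow> L b = h b"
    using GL_extend[OF assms(1,2) _ h] by metis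
  have "L c = c" if "c \<in> C" for c using L(2) that assms(3) by (auto simp: h_def)
  \<comment> \<open>As \<open>L\<close> fixes \<open>C\<close> pointwise it also fixes the sum, so
    \<open>insert w B\<close> goes to \<open>insert w C \<union> E\<close>, whose image under
    \<open>f\<close> is independent.\<close>
  then have "L w = w" by (simp add: w_def GL_sum[OF L(1)])
  moreover have "L ` B = C \<union> E" using L(2) h by (auto simp: bij_betw_def)
  ultimately have "f ` L ` insert w B = f ` (insert w C \<union> E)" by simp
  then have "free_image (f ` L ` insert w B)"
    using E(5)[of "insert w C"] f(2) free_image_independent by simp
  then show ?thesis
    using free_image_image f(1) L(1) GL_subset unfolding w_def by blast
qed

end

locale closed_supergroup_fixing_0 = closed_supergroup scale G
  for scale :: "bit \<Rightarrow> 'v::ab_group_add \<Rightarrow> 'v" and G +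
  assumes fixes_0: "g \<in> G \<Longrightarrow> g 0 = 0"
begin

lemma eq_0_iff: "g \<in> G \<Longrightarrow> g x = 0 \<longleftrightarrow> x = 0"
  by (metis eq_iff fixes_0)

lemma sum_preserved_if_not_free_image:
  assumes B: "finite B" "independent B" "B \<noteq> {}" "\<not> free_image (insert (\<Sum>B) B)"
    and smaller: "\<And>S. finite S \<Longrightarrow> 0 \<notin> S \<Longrightarrow> card S \<le> card B \<Longrightarrow> free_image S"
    and f: "f \<in> G" and C: "finite C" "independent C" "card C = card B" "independent (f ` C)"
  shows "f (\<Sum>C) = (\<Sum>c\<in>C. f c)"
proof -
  define w where "w = \<Sum>C"
  obtain h where h: "bij_betw h B C" using finite_same_card_bij[OF B(1) C(1)] C(3) by auto
  obtain L where L: "L \<in> GL scale" "\<And>b. b \<in> B \<Longrightarrow> L b = h b"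
    using GL_extend[OF B(1,2) C(2) h] by metis
  have LB: "L ` B = C" using L(2) h by (auto simp: bij_betw_def)
  have "L (\<Sum>B) = \<Sum>C"
    using L(2) GL_sum[OF L(1), of "\<lambda>x. x" B] sum.reindex_bij_betw[OF h, of "\<lambda>x. x"] by simp
  then have "L ` insert (\<Sum>B) B = insert w C" using LB by (simp add: w_def)
  then have not_free: "\<not> free_image (insert w C)"
    using B(4) free_image_image L(1) GL_subset by (metis subsetD)
  then have not_free': "\<not> free_image (insert (f w) (f ` C))"
    using free_image_image[OF f, of "insert w C"] by auto
  have inj: "inj_on f C" using bij[OF f] by (meson bij_is_inj inj_on_subset subset_UNIV)
  have "w \<noteq> 0"
  proof
    assume "w = 0"
    then have "C = {}"
      \<comment> \<open>For nonempty \<open>C\<close>, the sum with all coefficients equal to 1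
        would be a nontrivial relation.\<close>
      using C independentD[of C C "\<lambda>_. 1"] by (auto simp: w_def)
    then show False using B(1,3) C(3) by simp
  qed
  have "w \<notin> C" using not_free free_image_independent[OF C(2)] by (metis insert_absorb)
  have "f w \<in> span (f ` C)"
    using not_free' free_image_independent independent_insertI[OF _ C(4)] by blast
  then obtain D where D: "finite D" "D \<subseteq> f ` C" "f w = \<Sum>D" by (rule span_sumE)
  have "D = f ` C"
  proof (rule ccontr)
    assume "D \<noteq> f ` C"
    then have "card D < card (f ` C)" using D(2) C(1) by (simp add: psubset_card_mono psubset_eq)
    then have "card (insert (f w) D) \<le> card B"
      using C(1,3) D(1) inj by (simp add: card_image card_insert_if)
    moreover have "0 \<notin> f ` C" using C(4) dependent_zero by blast
    then have "0 \<notin> insert (f w) D" using D(2) \<open>w \<noteq> 0\<close> eq_0_iff[OF f] by auto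
    ultimately have "free_image (insert (f w) D)" using smaller D(1) by simp
    then have "free_image (insert (f w) (f ` C))"
      using free_image_insert_sum[OF _ C(4) D(2)] C(1) D(3) by simp
    then show False using not_free' by simp
  qed
  then show ?thesis using D(3) sum.reindex[OF inj, of "\<lambda>x. x"] by (simp add: w_def)
qed

text \<open>
  Otherwise the defect \<open>\<delta> = f (x + y) + f x + f y\<close> of a nonlinear \<open>f\<close> in \<open>G\<close> does not depend on the
  distinct nonzero vectors \<open>x\<close>, \<open>y\<close>: decompose \<open>x + y + c + d + \<Sum>E\<close> with generic \<open>c\<close>, \<open>d\<close>, \<open>E\<close> as
  \<open>x + y + (c + d) + \<Sum>E\<close> and as \<open>(x + y) + c + d + \<Sum>E\<close>.  Then \<open>f z = \<delta>\<close> gives \<open>f (z + t) = f t\<close>.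
\<close>

lemma free_image_insert_full_sum:
  assumes B: "finite B" "independent B" "2 \<le> card B"
    and smaller: "\<And>S. finite S \<Longrightarrow> 0 \<notin> S \<Longrightarrow> card S \<le> card B \<Longrightarrow> free_image S"
    and nonlinear: "\<not> G \<subseteq> GL scale"
  shows "free_image (insert (\<Sum>B) B)"
proof (rule ccontr)
  assume not_free: "\<not> free_image (insert (\<Sum>B) B)"
  have key: "f (\<Sum>C) = (\<Sum>c\<in>C. f c)"
    if "f \<in> G" "finite C" "independent C" "card C = card B" "independent (f ` C)" for f C
  proof (rule sum_preserved_if_not_free_image[OF B(1,2) _ not_free])
    show "B \<noteq> {}" using B(3) by auto
  qed (use smaller that in auto)
  obtain f where f: "f \<in> G" "f \<notin> GL scale" using nonlinear by auto
  then obtain x y where xy: "f (x + y) \<noteq> f x + f y" using bij by (auto simp: GL_iff)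
  have nz: "x \<noteq> 0" "y \<noteq> 0" "x \<noteq> y"
    using xy fixes_0[OF f(1)] by auto
  have fpair: "independent {f u, f v}" if "u \<noteq> 0" "v \<noteq> 0" "u \<noteq> v" for u v
    using that f(1) by (intro independent_pair) (auto simp: eq_0_iff eq_iff)
  show False
  \<comment> \<open>With two vectors there is no room for three summands, but here
    \<open>key\<close> is already additivity on \<open>{x, y}\<close>.\<close>
  proof (cases "card B = 2")
    case True
    then show False
      using key[OF f(1), of "{x, y}"] nz xy fpair independent_pair[OF nz] by simp
  next
    case False
    then have card: "3 \<le> card B" using B(3) by simp
    define D where "D u v = f (u + v) + f u + f v" for u v
    have const: "D u v = D u' v'"
      if u: "u \<noteq> 0" "v \<noteq> 0" "u \<noteq> v" and u': "u' \<noteq> 0" "v' \<noteq> 0" "u' \<noteq> v'" for u v u' v'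
    proof -
      have inj: "inj f" using f(1) bij bij_is_inj by blast
      \<comment> \<open>Collecting both pairs and their sums lets the same \<open>c\<close>,
        \<open>d\<close>, \<open>E\<close> serve for both; each defect is then compared with
        \<open>D c d\<close>.\<close>
      define A where "A = {u, v, u + v, u', v', u' + v'}"
      have "finite A" by (simp add: A_def)
      then obtain c where c: "c \<notin> span A" "f c \<notin> span (f ` A)"
        using exists_avoiding[OF inj finite_span finite_span, of A "f ` A"] by auto
      let ?A = "insert c A"
      have "finite ?A" using \<open>finite A\<close> by simp
      then obtain d where d: "d \<notin> span ?A" "f d \<notin> span (f ` ?A)" "f (c + d) \<notin> span (f ` ?A)"
        using exists_avoiding[OF inj finite_span finite_span, of ?A "f ` ?A" c] by blast
      define P where "P = A \<union> {c, d, c + d}"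
      \<comment> \<open>Three vectors together with \<open>E\<close> have the size to which
        \<open>key\<close> applies; \<open>card\<close> ensures that the subtraction does not
        truncate.\<close>
      obtain E where E: "finite E" "card E = card B - 3" "E \<inter> P = {}"
        "\<And>T. T \<subseteq> P \<Longrightarrow> independent T \<Longrightarrow> independent (T \<union> E)"
        "\<And>T. T \<subseteq> P \<Longrightarrow> independent (f ` T) \<Longrightarrow> independent (f ` (T \<union> E))"
        using exists_generic[OF inj, of P "card B - 3"] by (auto simp: P_def \<open>finite A\<close>)
      have triple: "f (p + q + r + \<Sum>E) = f p + f q + f r + (\<Sum>e\<in>E. f e)"
        if pqr: "{p, q, r} \<subseteq> P" "p \<noteq> 0" "q \<noteq> 0" "p \<noteq> q" "r \<notin> span {p, q}" "f r \<notin> span {f p, f q}"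
        for p q r
      proof -
        have r: "r \<noteq> p" "r \<noteq> q" using pqr(5) by (auto simp: span_pair)
        have indep: "independent {p, q, r}" "independent (f ` {p, q, r})"
          using independent_insertI[OF pqr(5) independent_pair[OF pqr(2-4)]]
            independent_insertI[OF pqr(6) fpair[OF pqr(2-4)]]
          by (simp_all add: insert_commute)
        have disj: "{p, q, r} \<inter> E = {}" using E(3) pqr(1) by blast
        have "card ({p, q, r} \<union> E) = card B"
          using card E(1,2) r pqr(4) by (subst card_Un_disjoint[OF _ _ disj]) auto
        then have "f (\<Sum>({p, q, r} \<union> E)) = (\<Sum>e\<in>{p, q, r} \<union> E. f e)"
          using key[OF f(1), of "{p, q, r} \<union> E"] E(1) E(4,5)[OF pqr(1)] indep by simp
        then show ?thesis
          using r pqr(4) E(1) by (simp add: sum.union_disjoint[OF _ _ disj] add.assoc del: Un_insert_left)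
      qed
      have "D p q = D c d" if pq: "p \<noteq> 0" "q \<noteq> 0" "p \<noteq> q" "{p, q, p + q} \<subseteq> A" for p q
      proof -
        have sub: "span {p, q} \<subseteq> span A" "span {f p, f q} \<subseteq> span (f ` ?A)"
          "span {p + q, c} \<subseteq> span ?A" "span {f (p + q), f c} \<subseteq> span (f ` ?A)"
          using pq(4) by (auto intro!: span_mono)
        have cd: "c + d \<notin> span A"
        proof
          assume "c + d \<in> span A"
          then have "c + d \<in> span ?A" using span_mono[OF subset_insertI] by blast
          then have "c + (c + d) \<in> span ?A" by (rule span_add[rotated]) (simp add: span_base)
          then show False using d(1) by simp
        qed
        have "f (p + q + (c + d) + \<Sum>E) = f p + f q + f (c + d) + (\<Sum>e\<in>E. f e)"
        proof (rule triple)
          show "c + d \<notin> span {p, q}" using cd sub by blast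
          show "f (c + d) \<notin> span {f p, f q}" using d(3) sub by blast
        qed (use pq in \<open>auto simp: P_def\<close>)
        moreover have "f (p + q + c + d + \<Sum>E) = f (p + q) + f c + f d + (\<Sum>e\<in>E. f e)"
        proof (rule triple)
          show "d \<notin> span {p + q, c}" using d(1) sub by blast
          show "f d \<notin> span {f (p + q), f c}" using d(2) sub by blast
          show "c \<noteq> 0" using c(1) span_zero by blast
          have "p + q \<in> span A" using pq(4) by (auto intro: span_base)
          then show "p + q \<noteq> c" using c(1) by blast
        qed (use pq in \<open>auto simp: P_def\<close>)
        ultimately have "f p + f q + f (c + d) = f (p + q) + f c + f d"
          by (simp add: add.assoc)
        then have "f (p + q) + (f p + f q + f (c + d)) = f c + f d" by (simp add: add.assoc)
        then have "f (p + q) + f p + f q + f (c + d) + f (c + d) = f c + f d + f (c + d)"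
          by (simp only: add.assoc)
        then show ?thesis by (simp add: D_def add.assoc)
      qed
      from this[of u v] this[of u' v'] u u' show ?thesis by (simp add: A_def)
    qed
    define \<delta> where "\<delta> = D x y"
    have "\<delta> \<noteq> 0" using xy by (simp add: \<delta>_def D_def add.assoc)
    define z where "z = inv f \<delta>"
    have fz: "f z = \<delta>" using f(1) by (simp add: z_def)
    then have z: "z \<noteq> 0" using \<open>\<delta> \<noteq> 0\<close> fixes_0[OF f(1)] by auto
    obtain t where t: "t \<noteq> 0" "t \<noteq> z" using infinite_UNIV ex_new_if_finite[of "{0, z}"] by auto
    have "D z t = \<delta>" unfolding \<delta>_def using z t nz by (intro const) auto
    then have "f (z + t) + f t = 0" by (simp add: D_def fz add.assoc)
    then have "z + t = t" using eq_iff[OF f(1)] by simp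
    then show False using z by simp
  qed
qed

text \<open>By induction all but one vector of \<open>S\<close> are made independent. If the image
  \<open>w\<close> of the last one is the sum of a proper subset \<open>C\<close> of the others,
  induction applies to \<open>insert w C\<close>; if it is the sum of all of them,
  \<open>free_image_insert_full_sum\<close> applies.\<close>

lemma free_image_finite:
  assumes nonlinear: "\<not> G \<subseteq> GL scale" and "finite S" "0 \<notin> S"
  shows "free_image S"
  using assms(2,3)
proof (induction "card S" arbitrary: S rule: less_induct)
  case less
  show ?case
  proof (cases "S = {}")
    case True
    then show ?thesis using free_image_independent[OF independent_empty] by simp
  next
    case False
    then obtain s where s: "s \<in> S" by auto
    have "card (S - {s}) < card S" using s less.prems(1) by (metis card_Diff1_less)
    then obtain g where g: "g \<in> G" "independent (g ` (S - {s}))"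
      using less.hyps[of "S - {s}"] less.prems by (auto simp: free_image_def)
    define B where "B = g ` (S - {s})"
    define w where "w = g s"
    have img: "g ` S = insert w B" using s by (auto simp: B_def w_def)
    have finB: "finite B" using less.prems by (simp add: B_def)
    have "w \<notin> B" using eq_iff[OF g(1)] by (auto simp: B_def w_def)
    have "w \<noteq> 0" using s less.prems eq_0_iff[OF g(1)] by (auto simp: w_def)
    have cardB: "Suc (card B) = card S"
    proof -
      have "card (g ` S) = card S" using bij[OF g(1)] by (metis bij_is_inj card_image inj_on_subset subset_UNIV)
      then show ?thesis using img finB \<open>w \<notin> B\<close> by simp
    qed
    have indep: "independent B" using g(2) by (simp add: B_def)
    have smaller: "free_image T" if "finite T" "0 \<notin> T" "card T \<le> card B" for T
      using less.hyps[of T] that cardB by simp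
    have "free_image (insert w B)"
    proof (cases "w \<in> span B")
      case False
      then show ?thesis using free_image_independent independent_insertI[OF _ indep] by blast
    next
      case True
      then obtain C where C: "finite C" "C \<subseteq> B" "w = \<Sum>C" by (rule span_sumE)
      \<comment> \<open>An empty sum would give \<open>w = 0\<close>, and a single summand would put
        \<open>w\<close> in \<open>B\<close>.\<close>
      have "C \<noteq> {}" "\<nexists>c. C = {c}" using C \<open>w \<noteq> 0\<close> \<open>w \<notin> B\<close> by auto
      then have "2 \<le> card C"
        using C(1) by (metis One_nat_def card_0_eq card_1_singletonE not_less_eq_eq numeral_2_eq_2 le_SucE le_0_eq)
      show ?thesis
      proof (cases "C = B")
        case True
        then show ?thesis
          using free_image_insert_full_sum[OF finB indep _ smaller nonlinear] \<open>2 \<le> card C\<close> C(3) by simp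
      next
        case False
        then have "card (insert w C) \<le> card B"
          using C(1,2) finB psubset_card_mono[of B C] by (simp add: card_insert_if psubset_eq)
        moreover have "0 \<notin> insert w C" using C(2) indep \<open>w \<noteq> 0\<close> dependent_zero by blast
        ultimately have "free_image (insert (\<Sum>C) C)" using smaller C(1,3) by simp
        then show ?thesis using free_image_insert_sum[OF finB indep C(2)] C(3) by simp
      qed
    qed
    then show ?thesis using free_image_image[OF g(1)] img by metis
  qed
qed

text \<open>On a finite set, \<open>g\<close> makes the nonzero points independent and
  \<open>h\<close> does so for their images under \<open>f\<close>. A linear \<open>L\<close> links
  the two independent sets, so \<open>inv h \<circ> (L \<circ> g)\<close> agrees with
  \<open>f\<close> there, and closedness gives \<open>f \<in> G\<close>.\<close>

theorem eq_Sym0_if_nonlinear: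
  assumes nonlinear: "\<not> G \<subseteq> GL scale"
  shows "G = Sym\<^sub>0"
proof
  show "G \<subseteq> Sym\<^sub>0" using bij fixes_0 by (auto simp: Sym\<^sub>0_def Sym_def)
  show "Sym\<^sub>0 \<subseteq> G"
  proof
    fix f :: "'v \<Rightarrow> 'v" assume "f \<in> Sym\<^sub>0"
    then have f: "bij f" "f 0 = 0" by (auto simp: Sym\<^sub>0_def Sym_def)
    show "f \<in> G"
    proof (rule closed[OF f(1)])
      fix F :: "'v set" assume "finite F"
      define S where "S = F - {0}"
      have "finite S" "0 \<notin> S" using \<open>finite F\<close> by (auto simp: S_def)
      moreover have "0 \<notin> f ` S" using f \<open>0 \<notin> S\<close> by (metis bij_is_inj imageE inj_eq)
      ultimately obtain g h where g: "g \<in> G" "independent (g ` S)" and h: "h \<in> G" "independent (h ` f ` S)"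
        using free_image_finite[OF nonlinear] by (metis finite_imageI free_image_def)
      have "bij (h \<circ> f \<circ> inv g)"
        using bij g(1) h(1) f(1) inverse by (intro bij_comp) auto
      then have "inj_on (h \<circ> f \<circ> inv g) (g ` S)" by (meson bij_is_inj inj_on_subset subset_UNIV)
      then have biject: "bij_betw (h \<circ> f \<circ> inv g) (g ` S) (h ` f ` S)"
        using g(1) by (simp add: bij_betw_def image_comp comp_def)
      have "\<exists>L\<in>GL scale. \<forall>b\<in>g ` S. L b = (h \<circ> f \<circ> inv g) b"
        by (rule GL_extend[OF finite_imageI[OF \<open>finite S\<close>] g(2) h(2) biject])
      then obtain L where L: "L \<in> GL scale" "\<And>x. x \<in> S \<Longrightarrow> L (g x) = h (f x)"
        using g(1) by auto
      let ?k = "inv h \<circ> (L \<circ> g)"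
      have k: "?k \<in> G" 
        using comp[OF inverse[OF h(1)] comp[OF subsetD[OF GL_subset L(1)] g(1)]] .
      moreover have "?k x = f x" if "x \<in> F" for x
      proof (cases "x = 0")
        case True
        then show ?thesis using fixes_0[OF k] f(2) by simp
      next
        case False
        then show ?thesis using L(2)[of x] that h(1) by (simp add: S_def)
      qed
      ultimately show "\<exists>k\<in>G. \<forall>x\<in>F. k x = f x" by blast
    qed
  qed
qed

end

section \<open>Closed groups moving zero, and the classification\<close>

context F2_omega
begin

lemma additive_imp_linear:
  fixes g :: "'v \<Rightarrow> 'v"
  assumes "\<And>x y z. g (x + y + z) = g x + g y + g z" "g 0 = 0"
  shows "g (x + y) = g x + g y"
  using assms(1)[of x y 0] assms(2) by simp

lemma bij_translation: "bij (\<lambda>v. v + a :: 'v)"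
  by (rule bij_betw_byWitness[of _ "\<lambda>v. v + a"]) (auto simp: add.assoc)

text \<open>Linear bijections and translations preserve the ternary sum, and this property passes to
  products and inverses. Conversely, following such a map by the translation by \<open>g 0\<close>
  makes it additive.\<close>

lemma AGL_iff: "g \<in> AGL scale \<longleftrightarrow> bij g \<and> (\<forall>x y z. g (x + y + z) = g x + g y + g z)"
proof
  have generator: "bij h \<and> (\<forall>x y z. h (x + y + z) = h x + h y + h z)"
    if "h \<in> GL scale \<union> {\<lambda>v. v + a | a. True}" for h
    using that by (auto simp: GL_iff bij_translation ac_simps)
  assume "g \<in> AGL scale"
  then show "bij g \<and> (\<forall>x y z. g (x + y + z) = g x + g y + g z)"
    unfolding AGL_def
  proof (induction rule: generate.induct)
    case one
    then show ?case using bij_id by (simp add: BijGroup_def id_def)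
  next
    case (incl h)
    then show ?case by (rule generator)
  next
    case (inv h)
    note h = generator[OF inv]
    then have "m_inv (BijGroup UNIV) h = inv_into UNIV h"
      by (subst inv_BijGroup) (auto simp: Bij_def)
    moreover have "inv_into UNIV h (x + y + z) = inv_into UNIV h x + inv_into UNIV h y + inv_into UNIV h z" for x y z
      using h by (metis bij_inv_eq_iff)
    ultimately show ?case using h bij_imp_bij_inv by auto
  next
    case (eng h k)
    moreover have "h \<otimes>\<^bsub>BijGroup UNIV\<^esub> k = h \<circ> k"
      using eng by (auto simp: BijGroup_def Bij_def compose_def)
    ultimately show ?case using bij_comp[of k h] by (simp add: comp_def)
  qed
next
  assume g: "bij g \<and> (\<forall>x y z. g (x + y + z) = g x + g y + g z)"
  define a where "a = g 0"
  define t where "t v = v + a" for v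
  \<comment> \<open>In characteristic two \<open>t\<close> is its own inverse, so
    \<open>L 0 = 0\<close> and \<open>g\<close> is recovered as \<open>t \<circ> L\<close>.\<close>
  define L where "L = t \<circ> g"
  have t: "bij t" unfolding t_def by (rule bij_translation)
  have bL: "bij L" using t g by (simp add: L_def bij_comp)
  have "L (x + y) = L x + L y" for x y
  proof -
    have "g (x + y + 0) = g x + g y + g 0" using g by blast
    then show ?thesis by (simp add: L_def t_def a_def ac_simps)
  qed
  then have "L \<in> GL scale" using bL by (simp add: GL_iff)
  then have "L \<in> AGL scale" "t \<in> AGL scale"
    by (auto simp: AGL_def t_def[abs_def] intro!: generate.incl)
  then have "t \<otimes>\<^bsub>BijGroup UNIV\<^esub> L \<in> AGL scale"
    by (simp add: AGL_def generate.eng)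
  moreover have "t \<otimes>\<^bsub>BijGroup UNIV\<^esub> L = g"
    using t bL by (auto simp: BijGroup_def Bij_def compose_def L_def t_def add.assoc fun_eq_iff)
  ultimately show "g \<in> AGL scale" by simp
qed

lemma GL_subset_AGL: "GL scale \<subseteq> AGL scale"
  by (auto simp: GL_iff AGL_iff)

end

section \<open>Points fixed by the stabilizer of three points\<close>

context closed_supergroup
begin

text \<open>A group-theoretic form of definable closure. For \<open>AGL\<close> and three distinct
  points it consists of these points and their sum, which is how the ternary addition is recovered
  from the group.\<close>

definition fixpoints :: "'v \<Rightarrow> 'v \<Rightarrow> 'v \<Rightarrow> 'v set" where
  "fixpoints p q r = {s. \<forall>h\<in>G. h p = p \<and> h q = q \<and> h r = r \<longrightarrow> h s = s}"

text \<open>Conjugation by \<open>g\<close> carries the pointwise stabilizer of \<open>p\<close>,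
  \<open>q\<close>, \<open>r\<close> to that of their images; the reverse inclusion uses
  \<open>inv g\<close>.\<close>

lemma fixpoints_image:
  assumes g: "g \<in> G"
  shows "fixpoints (g p) (g q) (g r) = g ` fixpoints p q r"
proof -
  have sub: "g s \<in> fixpoints (g p) (g q) (g r)" if g: "g \<in> G" and s: "s \<in> fixpoints p q r" for g p q r s
    unfolding fixpoints_def
  proof (intro CollectI ballI impI)
    fix h assume h: "h \<in> G" "h (g p) = g p \<and> h (g q) = g q \<and> h (g r) = g r"
    have "inv g \<circ> (h \<circ> g) \<in> G" using comp[OF inverse[OF g] comp[OF h(1) g]] .
    then have "(inv g \<circ> (h \<circ> g)) s = s" using s h g by (auto simp: fixpoints_def)
    then show "h (g s) = g s" using apply_inv[OF g, of "h (g s)"] by simp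
  qed
  show ?thesis
  proof (intro equalityI subsetI)
    fix s assume "s \<in> fixpoints (g p) (g q) (g r)"
    then have "inv g s \<in> fixpoints p q r" using sub[OF inverse[OF g]] g by fastforce
    then show "s \<in> g ` fixpoints p q r" using g by (intro image_eqI[of _ _ "inv g s"]) auto
  qed (use sub[OF g] in blast)
qed

lemma fixpoints_base: "{p, q, r} \<subseteq> fixpoints p q r"
  by (auto simp: fixpoints_def)

lemma fixpoints_rotate: "fixpoints q r p = fixpoints p q r"
  by (auto simp: fixpoints_def)

text \<open>A vector outside the span can be moved to another vector by a linear map that fixes the
  span pointwise.\<close>

lemma fixpoints_subset_span: "fixpoints p q r \<subseteq> span {p, q, r}"
proof
  fix s assume s: "s \<in> fixpoints p q r"
  show "s \<in> span {p, q, r}"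
  proof (rule ccontr)
    assume notin: "s \<notin> span {p, q, r}"
    obtain B where B: "B \<subseteq> {p, q, r}" "independent B" "{p, q, r} \<subseteq> span B"
      using maximal_independent_subset by metis
    have fin: "finite B" using B(1) finite_subset by auto
    have sB: "s \<notin> span B" using notin span_mono[OF B(1)] by blast
    then have "s \<notin> B" using span_base by blast
    have "finite (span (insert s B))" using fin by (intro finite_span) auto
    then obtain t where t: "t \<notin> span (insert s B)" using ex_new_if_finite[OF infinite_UNIV] by metis
    then have "t \<notin> span B" "t \<noteq> s" "t \<notin> B"
      using span_mono[OF subset_insertI, of B s] span_base[of _ "insert s B"] by auto
    then have "bij_betw (\<lambda>b. if b = s then t else b) (insert s B) (insert t B)"
      using \<open>s \<notin> B\<close> by (auto simp: bij_betw_def inj_on_def)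
    from GL_extend[OF _ independent_insertI[OF sB B(2)] independent_insertI[OF \<open>t \<notin> span B\<close> B(2)] this]
    obtain L where L: "L \<in> GL scale" "\<forall>b\<in>insert s B. L b = (if b = s then t else b)"
      using fin by blast
    have "L b = b" if "b \<in> B" for b using L(2) that \<open>s \<notin> B\<close> by auto
    then have "L x = x" if "x \<in> span B" for x
      using GL_eq_on_span[OF L(1) _ that] by blast
    then have "L s = s" using s B(3) L(1) GL_subset by (auto simp: fixpoints_def)
    then show False using L(2) \<open>t \<noteq> s\<close> by simp
  qed
qed

end

text \<open>The case of a group that moves \<open>0\<close> but in which fixing \<open>0\<close>
  forces linearity; it turns out to be \<open>AGL\<close>.\<close>

locale linear_stabilizer = closed_supergroup scale G
  for scale :: "bit \<Rightarrow> 'v::ab_group_add \<Rightarrow> 'v" and G +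
  assumes stabilizer_linear: "g \<in> G \<Longrightarrow> g 0 = 0 \<Longrightarrow> g \<in> GL scale"
    and transitive: "\<exists>g\<in>G. g p = 0"
begin

lemma stabilizer_additive: "g \<in> G \<Longrightarrow> g 0 = 0 \<Longrightarrow> g (x + y) = g x + g y"
  using stabilizer_linear by (auto simp: GL_iff)

lemma fixpoints_0:
  assumes "a \<noteq> 0" "b \<noteq> 0" "a \<noteq> b"
  shows "fixpoints 0 a b = {0, a, b, a + b}"
proof
  show "fixpoints 0 a b \<subseteq> {0, a, b, a + b}"
    using fixpoints_subset_span[of 0 a b] by (simp add: span_pair)
  show "{0, a, b, a + b} \<subseteq> fixpoints 0 a b"
    by (auto simp: fixpoints_def stabilizer_additive)
qed

text \<open>Transitivity moves \<open>p\<close> to \<open>0\<close>, where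
  \<open>fixpoints_0\<close> lists the fixed points.\<close>

lemma card_fixpoints:
  assumes "p \<noteq> q" "q \<noteq> r" "p \<noteq> r"
  shows "card (fixpoints p q r) = 4"
proof -
  obtain g where g: "g \<in> G" "g p = 0" using transitive by blast
  have ne: "g q \<noteq> 0" "g r \<noteq> 0" "g q \<noteq> g r" using assms g eq_iff[OF g(1)] by metis+
  have "card (fixpoints p q r) = card (g ` fixpoints p q r)"
    using bij[OF g(1)] by (metis bij_is_inj card_image inj_on_subset subset_UNIV)
  also have "g ` fixpoints p q r = {0, g q, g r, g q + g r}"
    using fixpoints_image[OF g(1), of p q r] fixpoints_0[OF ne] g(2) by simp
  also have "card \<dots> = 4" using ne by auto
  finally show ?thesis .
qed

lemma finite_fixpoints: "p \<noteq> q \<Longrightarrow> q \<noteq> r \<Longrightarrow> p \<noteq> r \<Longrightarrow> finite (fixpoints p q r)"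
  using card_fixpoints[of p q r] card.infinite by fastforce

lemma fixpoints_too_many:
  assumes "p \<noteq> q" "q \<noteq> r" "p \<noteq> r" "s \<in> fixpoints p q r" "t \<in> fixpoints p q r"
    "s \<notin> {p, q, r}" "t \<notin> {p, q, r}"
  shows "s = t"
proof (rule ccontr)
  assume "s \<noteq> t"
  then have "card {p, q, r, s, t} = 5" using assms by auto
  moreover have "card {p, q, r, s, t} \<le> 4"
    using card_mono[OF finite_fixpoints[OF assms(1-3)], of "{p, q, r, s, t}"]
      card_fixpoints[OF assms(1-3)] fixpoints_base[of p q r] assms(4,5) by simp
  ultimately show False by simp
qed

text \<open>A linear map permuting \<open>p\<close>, \<open>q\<close>, \<open>r\<close> cyclically
  would make \<open>q + r\<close> a fixed point as well, but there is only one besides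
  \<open>p\<close>, \<open>q\<close>, \<open>r\<close>.\<close>

lemma add_notin_fixpoints:
  assumes ne: "p \<noteq> 0" "q \<noteq> 0" "p \<noteq> q" "r \<notin> span {p, q}"
  shows "p + q \<notin> fixpoints p q r"
proof
  assume pq: "p + q \<in> fixpoints p q r"
  have r: "r \<noteq> 0" "r \<noteq> p" "r \<noteq> q" "r \<noteq> p + q" using ne(4) by (auto simp: span_pair)
  have indep: "independent {p, q, r}"
    using independent_insertI[OF ne(4) independent_pair[OF ne(1-3)]] by (simp add: insert_commute)
  define h where "h x = (if x = p then q else if x = q then r else p)" for x
  have "bij_betw h {p, q, r} {p, q, r}"
    using r ne by (auto simp: h_def bij_betw_def inj_on_def)
  then obtain L where L: "L \<in> GL scale" "\<forall>b\<in>{p, q, r}. L b = h b"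
    using GL_extend[OF _ indep indep] by auto
  then have "L p = q" "L q = r" "L r = p" using r ne by (auto simp: h_def)
  moreover have "L (p + q) = L p + L q" using L(1) by (simp add: GL_iff)
  moreover have "L (p + q) \<in> fixpoints (L p) (L q) (L r)"
    using fixpoints_image[OF subsetD[OF GL_subset L(1)]] pq by blast
  ultimately have "q + r \<in> fixpoints q r p" by simp
  then have "q + r \<in> fixpoints p q r" by (simp add: fixpoints_rotate)
  then have "p + q = q + r"
    using pq r ne by (intro fixpoints_too_many[of p q r]) (auto simp: add.commute)
  then show False using r by (simp add: add.commute)
qed

text \<open>If one point is \<open>0\<close>, this is \<open>fixpoints_0\<close>. If the points are
  nonzero and dependent, their span has just four elements, all of which must be fixed. If they are
  independent, every candidate in the span for the fourth fixed point except the full sum is ruled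
  out.\<close>

lemma add3_in_fixpoints:
  assumes ne: "p \<noteq> q" "q \<noteq> r" "p \<noteq> r"
  shows "p + q + r \<in> fixpoints p q r"
proof -
  have with_0: "a + b \<in> fixpoints 0 a b" if "a \<noteq> 0" "b \<noteq> 0" "a \<noteq> b" for a b
    using fixpoints_0[OF that] by simp
  consider "p = 0" | "q = 0" | "r = 0" | "p \<noteq> 0" "q \<noteq> 0" "r \<noteq> 0" by blast
  then show ?thesis
  proof cases
    case 1
    then show ?thesis using with_0[of q r] ne by simp
  next
    case 2
    then show ?thesis
      using with_0[of r p] ne fixpoints_rotate[of q r p] by (simp add: add.commute fixpoints_rotate)
  next
    case 3
    then show ?thesis using with_0[of p q] ne by (simp add: fixpoints_rotate)
  next
    case nz: 4
    show ?thesis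
    proof (cases "r = p + q")
      case True
      have "fixpoints p q r \<subseteq> {0, p, q, p + q}"
        using fixpoints_subset_span[of p q r] unfolding True
        by (simp add: span_insert_eq insert_commute image_Un) (auto simp: add.left_commute add.commute)
      moreover have "card {0, p, q, p + q} = 4" using nz ne by auto
      ultimately have "fixpoints p q r = {0, p, q, p + q}"
        using card_fixpoints[OF ne] by (intro card_subset_eq) auto
      then show ?thesis using True by simp
    next
      case False
      have r: "r \<notin> span {p, q}" and p: "p \<notin> span {q, r}" and q: "q \<notin> span {r, p}"
        using nz ne False by (auto simp: span_pair add.commute)
      obtain s where s: "s \<in> fixpoints p q r" "s \<notin> {p, q, r}"
      proof -
        have "\<not> fixpoints p q r \<subseteq> {p, q, r}"
          using card_mono[of "{p, q, r}" "fixpoints p q r"] card_fixpoints[OF ne] ne by auto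
        then show ?thesis using that by blast
      qed
      have "s \<noteq> p + q" using add_notin_fixpoints[OF nz(1,2) ne(1) r] s(1) by blast
      moreover have "s \<noteq> q + r"
        using add_notin_fixpoints[OF nz(2,3) ne(2) p] s(1) by (auto simp: fixpoints_rotate)
      moreover have "s \<noteq> r + p"
        using add_notin_fixpoints[OF nz(3,1) ne(3)[symmetric] q] s(1) by (auto simp: fixpoints_rotate)
      moreover have "s \<noteq> 0"
      proof
        assume "s = 0"
        \<comment> \<open>If \<open>0\<close> were fixed, the stabilizer of the three points would
          be linear and would also fix \<open>p + q\<close>.\<close>
        then have "p + q \<in> fixpoints p q r"
          using s(1) by (auto simp: fixpoints_def stabilizer_additive)
        then show False using add_notin_fixpoints[OF nz(1,2) ne(1) r] by blast
      qed
      moreover have "s \<in> span {p, q, r}" using fixpoints_subset_span s(1) by blast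
      ultimately have "s = p + q + r"
        using s(2) by (auto simp: span_insert_eq ac_simps)
      then show ?thesis using s(1) by simp
    qed
  qed
qed

text \<open>The sum of three distinct vectors is the unique fourth fixed point, which
  \<open>g\<close> carries to the fourth fixed point of the images. With equal arguments both sides
  collapse in characteristic two.\<close>

lemma preserves_add3:
  assumes g: "g \<in> G"
  shows "g (x + y + z) = g x + g y + g z"
proof -
  consider "x = y" | "y = z" | "x = z" | "x \<noteq> y" "y \<noteq> z" "x \<noteq> z" by blast
  then show ?thesis
  proof cases
    case ne: 4
    then have gne: "g x \<noteq> g y" "g y \<noteq> g z" "g x \<noteq> g z" by (simp_all add: eq_iff[OF g])
    have notin: "a + b + c \<notin> {a, b, c}" if "a \<noteq> b" "b \<noteq> c" "a \<noteq> c" for a b c :: 'v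
    proof -
      have "a + b + c = a + (b + c)" "a + b + c = b + (a + c)" by (simp_all add: ac_simps)
      then have "a + b + c \<noteq> a" "a + b + c \<noteq> b" "a + b + c \<noteq> c"
        using that by simp_all
      then show ?thesis by simp
    qed
    have "g (x + y + z) \<in> fixpoints (g x) (g y) (g z)"
      using fixpoints_image[OF g] add3_in_fixpoints[OF ne] by blast
    then show ?thesis
      using fixpoints_too_many[OF gne _ add3_in_fixpoints[OF gne]] notin[OF ne] notin[OF gne]
      by (auto simp: eq_iff[OF g])
  qed (simp_all add: add.assoc, metis add.commute add_self_left)
qed

lemma eq_AGL: "G = AGL scale"
proof
  show "G \<subseteq> AGL scale" using bij preserves_add3 by (auto simp: AGL_iff)
  show "AGL scale \<subseteq> G"
  proof
    fix h assume "h \<in> AGL scale"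
    then have h: "bij h" "\<And>x y z. h (x + y + z) = h x + h y + h z" by (auto simp: AGL_iff)
    \<comment> \<open>Correcting \<open>h\<close> by an element of \<open>G\<close> so that it fixes
      \<open>0\<close> makes it linear and hence a member of \<open>G\<close>.\<close>
    obtain g where g: "g \<in> G" "g (h 0) = 0" using transitive by blast
    let ?k = "g \<circ> h"
    have "?k (x + y + z) = ?k x + ?k y + ?k z" for x y z
      by (simp add: h(2) preserves_add3[OF g(1)])
    then have "?k (x + y) = ?k x + ?k y" for x y
      using additive_imp_linear[of ?k] g(2) by simp
    moreover have "bij ?k" using h(1) bij[OF g(1)] by (simp add: bij_comp)
    ultimately have "?k \<in> G" using GL_subset by (auto simp: GL_iff)
    then have "inv g \<circ> ?k \<in> G" using comp inverse g(1) by blast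
    moreover have "inv g \<circ> ?k = h" using g(1) by (auto simp: fun_eq_iff)
    ultimately show "h \<in> G" by simp
  qed
qed

end

theorem (in closed_supergroup) classification:
  "G = GL scale \<or> G = AGL scale \<or> G = Sym\<^sub>0 \<or> G = Sym"
proof -
  interpret st: closed_supergroup scale "{g \<in> G. g 0 = 0}" by (rule closed_supergroup_stabilizer)
  interpret st: closed_supergroup_fixing_0 scale "{g \<in> G. g 0 = 0}" by unfold_locales auto
  have stab: "{g \<in> G. g 0 = 0} \<subseteq> GL scale \<or> {g \<in> G. g 0 = 0} = Sym\<^sub>0"
    using st.eq_Sym0_if_nonlinear by blast
  show ?thesis
  proof (cases "\<forall>g\<in>G. g 0 = 0")
    case True
    then have "{g \<in> G. g 0 = 0} = G" by auto
    then show ?thesis using stab GL_subset by auto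
  next
    case False
    then obtain g where g: "g \<in> G" "g 0 \<noteq> 0" by blast
    have transitive: "\<exists>h\<in>G. h p = 0" for p
    proof (cases "p = 0")
      case True
      have "id \<in> G" using GL_subset by (auto simp: GL_iff)
      then show ?thesis using True by (intro bexI[of _ id]) auto
    next
      case False
      \<comment> \<open>\<open>GL\<close> is transitive on nonzero vectors, and \<open>inv g\<close>
        then takes \<open>g 0\<close> to \<open>0\<close>.\<close>
      obtain L where L: "L \<in> GL scale" "L p = g 0" using GL_transitive[OF False g(2)] .
      have "inv g \<circ> L \<in> G" using comp[OF inverse[OF g(1)] subsetD[OF GL_subset L(1)]] .
      moreover have "(inv g \<circ> L) p = 0" using L(2) g(1) by simp
      ultimately show ?thesis by blast
    qed
    from stab show ?thesis
    proof
      assume "{g \<in> G. g 0 = 0} \<subseteq> GL scale"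
      then interpret linear_stabilizer scale G using transitive by unfold_locales auto
      show ?thesis using eq_AGL by simp
    next
      assume st: "{g \<in> G. g 0 = 0} = Sym\<^sub>0"
      have "f \<in> G" if "bij f" for f
      proof -
        obtain h where h: "h \<in> G" "h (f 0) = 0" using transitive by blast
        have "bij (h \<circ> f)" using that bij[OF h(1)] by (simp add: bij_comp)
        then have "h \<circ> f \<in> Sym\<^sub>0" using h(2) by (simp add: Sym\<^sub>0_def Sym_def)
        then have "inv h \<circ> (h \<circ> f) \<in> G" using st comp[OF inverse[OF h(1)]] by auto
        moreover have "inv h \<circ> (h \<circ> f) = f" using h(1) by (auto simp: fun_eq_iff)
        ultimately show ?thesis by simp
      qed
      then have "G = Sym" using bij by (auto simp: Sym_def)
      then show ?thesis by simp
    qed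
  qed
qed

section \<open>The four structures and their automorphism groups\<close>

context F2_omega
begin

lemma oligomorphic_if_GL_subset: "GL scale \<subseteq> Aut M \<Longrightarrow> oligomorphic M"
  using finite_GL_orbits countable_UNIV by unfold_locales (meson subsetD)+

lemma closed_supergroup_Aut: "GL scale \<subseteq> Aut M \<Longrightarrow> closed_supergroup scale (Aut M)"
  by unfold_locales (auto simp: Aut_comp Aut_inv intro: Aut_closed, auto simp: Aut_def)

lemma Aut_vector_structure: "Aut (vector_structure scale) = GL scale"
proof (intro equalityI subsetI)
  fix g assume g: "g \<in> Aut (vector_structure scale)"
  then have hom: "g (vector_op_interp scale f xs) = vector_op_interp scale f (map g xs)"
    if "length xs = vector_op_arity f" for f xs
    using that by (auto simp: Aut_def vector_structure_def)
  have "g (x + y) = g x + g y" for x y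
    using hom[of "[x, y]" VPlus] by simp
  then show "g \<in> GL scale" using g by (simp add: GL_iff Aut_def)
next
  fix g assume g: "g \<in> GL scale"
  have "g (vector_op_interp scale f xs) = vector_op_interp scale f (map g xs)"
    if "length xs = vector_op_arity f" for f xs
    using that g by (cases f) (auto simp: GL_0, auto simp: GL_def endo.linear_add endo.linear_scale)
  then show "g \<in> Aut (vector_structure scale)"
    using g by (auto simp: Aut_def vector_structure_def GL_iff)
qed

lemma Aut_affine_structure: "Aut affine_structure = AGL scale"
proof (intro equalityI subsetI)
  fix g :: "'v \<Rightarrow> 'v" assume g: "g \<in> Aut affine_structure"
  then have hom: "g (xs ! 0 + xs ! 1 + xs ! 2) = map g xs ! 0 + map g xs ! 1 + map g xs ! 2"
    if "length xs = 3" for xs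
    using that by (auto simp: Aut_def affine_structure_def)
  have "g (x + y + z) = g x + g y + g z" for x y z
    using hom[of "[x, y, z]"] by simp
  then show "g \<in> AGL scale" using g by (simp add: AGL_iff Aut_def)
qed (auto simp: Aut_def affine_structure_def AGL_iff)

lemma Aut_zero_structure: "Aut zero_structure = (Sym\<^sub>0 :: ('v \<Rightarrow> 'v) set)"
proof (intro equalityI subsetI)
  fix g :: "'v \<Rightarrow> 'v" assume g: "g \<in> Aut zero_structure"
  then have "map g xs \<in> {[0]} \<longleftrightarrow> xs \<in> {[0]}" if "length xs = 1" for xs
    using that unfolding Aut_def zero_structure_def by simp
  from this[of "[0]"] have "g 0 = 0" by simp
  then show "g \<in> Sym\<^sub>0" using g by (simp add: Sym\<^sub>0_def Sym_def Aut_def)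
next
  fix g :: "'v \<Rightarrow> 'v" assume "g \<in> Sym\<^sub>0"
  then have g: "bij g" "g 0 = 0" by (auto simp: Sym\<^sub>0_def Sym_def)
  have "map g xs = [0] \<longleftrightarrow> xs = [0]" for xs
    using g bij_is_inj[OF g(1)] by (auto simp: map_eq_Cons_conv) (metis inj_eq)
  then show "g \<in> Aut zero_structure" using g by (simp add: Aut_def zero_structure_def)
qed

lemma Aut_trivial_structure: "Aut trivial_structure = Sym"
  by (auto simp: Aut_def trivial_structure_def Sym_def)

lemma fo_reduct_vector_structure_iff: "fo_reduct R (vector_structure scale) \<longleftrightarrow> GL scale \<subseteq> Aut R"
  using oligomorphic.fo_reduct_iff[OF oligomorphic_if_GL_subset, of "vector_structure scale" R]
  by (simp add: Aut_vector_structure)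

text \<open>A nontrivial translation separates \<open>AGL\<close> and \<open>Sym\<close> from the
  groups fixing \<open>0\<close>. A transposition moving \<open>a + b\<close> but fixing
  \<open>0\<close>, \<open>a\<close>, \<open>b\<close> is not affine, which separates
  \<open>Sym\<^sub>0\<close> and \<open>Sym\<close> from \<open>GL\<close> and
  \<open>AGL\<close>.\<close>

lemma groups_distinct:
  "AGL scale \<noteq> GL scale" "Sym\<^sub>0 \<noteq> GL scale" "Sym \<noteq> GL scale"
  "AGL scale \<noteq> Sym\<^sub>0" "AGL scale \<noteq> Sym" "Sym\<^sub>0 \<noteq> (Sym :: ('v \<Rightarrow> 'v) set)"
proof -
  obtain a :: 'v where a: "a \<noteq> 0" using ex_new_if_finite[OF infinite_UNIV, of "{0}"] by auto
  obtain b where b: "b \<noteq> 0" "b \<noteq> a" using ex_new_if_finite[OF infinite_UNIV, of "{0, a}"] by auto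
  obtain c where c: "c \<notin> {0, a, b, a + b}" using ex_new_if_finite[OF infinite_UNIV, of "{0, a, b, a + b}"] by auto
  define t where "t v = v + a" for v
  have "bij t" unfolding t_def by (rule bij_translation)
  then have "t \<in> AGL scale" "t \<in> Sym"
    by (auto simp: AGL_iff Sym_def t_def ac_simps)
  moreover have "t \<notin> Sym\<^sub>0" "t \<notin> GL scale"
    using a GL_0[of t] by (auto simp: Sym\<^sub>0_def t_def)
  moreover define s where "s = transpose (a + b) c"
  have ab: "a + b \<notin> {0, a, b}" using a b by auto
  have "s 0 = 0" "s a = a" "s b = b" "s (a + b) = c"
    using c ab by (auto simp: s_def transpose_def)
  moreover have "s \<in> Sym\<^sub>0" "s \<in> Sym"
    using \<open>s 0 = 0\<close> by (auto simp: Sym\<^sub>0_def Sym_def s_def)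
  moreover have "s \<notin> AGL scale"
  proof
    assume "s \<in> AGL scale"
    then have "s (a + b + 0) = s a + s b + s 0" by (simp only: AGL_iff)
    then show False using \<open>s 0 = 0\<close> \<open>s a = a\<close> \<open>s b = b\<close> \<open>s (a + b) = c\<close> c by simp
  qed
  ultimately show
    "AGL scale \<noteq> GL scale" "Sym\<^sub>0 \<noteq> GL scale" "Sym \<noteq> GL scale"
    "AGL scale \<noteq> Sym\<^sub>0" "AGL scale \<noteq> Sym" "Sym\<^sub>0 \<noteq> (Sym :: ('v \<Rightarrow> 'v) set)"
    using GL_subset_AGL by blast+
qed

lemma interdefinable_iff:
  assumes "GL scale \<subseteq> Aut M" "GL scale \<subseteq> Aut N"
  shows "interdefinable M N \<longleftrightarrow> Aut M = Aut N"
  using oligomorphic.fo_reduct_iff[OF oligomorphic_if_GL_subset[OF assms(1)], of N]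
    oligomorphic.fo_reduct_iff[OF oligomorphic_if_GL_subset[OF assms(2)], of M]
  by (auto simp: interdefinable_def)

end

theorem corollary3p1:
  fixes scale :: "bit \<Rightarrow> 'v::ab_group_add \<Rightarrow> 'v"
  assumes "F2_omega scale"
  shows
    "let V = vector_structure scale;
         A = (affine_structure :: (unit, unit, 'v) fo_structure);
         Z = (zero_structure :: (unit, unit, 'v) fo_structure);
         T = (trivial_structure :: (unit, unit, 'v) fo_structure)
     in
       (fo_reduct V V \<and> fo_reduct A V \<and> fo_reduct Z V \<and> fo_reduct T V) \<and>
       (Aut V = GL scale \<and> Aut A = AGL scale \<and> Aut Z = Sym\<^sub>0 \<and> Aut T = Sym) \<and>
       (\<not> interdefinable V A \<and> \<not> interdefinable V Z \<and> \<not> interdefinable V T \<and>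
        \<not> interdefinable A Z \<and> \<not> interdefinable A T \<and> \<not> interdefinable Z T) \<and>
       (\<forall>R :: ('f, 'r, 'v) fo_structure. fo_reduct R V \<longrightarrow>
          interdefinable R V \<or> interdefinable R A \<or> interdefinable R Z \<or> interdefinable R T)"
proof -
  interpret F2_omega scale by (rule assms)
  note Aut = Aut_vector_structure Aut_affine_structure Aut_zero_structure Aut_trivial_structure
  have sub: "GL scale \<subseteq> GL scale" "GL scale \<subseteq> AGL scale" "GL scale \<subseteq> Sym\<^sub>0" "GL scale \<subseteq> Sym"
    using GL_subset_AGL GL_0 by (auto simp: Sym\<^sub>0_def Sym_def GL_iff)
  have "interdefinable R (vector_structure scale) \<or> interdefinable R (affine_structure :: (unit, unit, 'v) fo_structure) \<or>
      interdefinable R (zero_structure :: (unit, unit, 'v) fo_structure) \<or>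
      interdefinable R (trivial_structure :: (unit, unit, 'v) fo_structure)"
    if "GL scale \<subseteq> Aut R" for R :: "('f, 'r, 'v) fo_structure"
    \<comment> \<open>\<open>Aut R\<close> is closed and so is one of the four groups; structures
      with equal groups above \<open>GL\<close> are interdefinable.\<close>
    using closed_supergroup.classification[OF closed_supergroup_Aut[OF that]]
    by (simp add: interdefinable_iff[OF that] Aut sub)
  then show ?thesis
    using groups_distinct by (simp add: Let_def Aut sub interdefinable_iff fo_reduct_vector_structure_iff)
qed

end
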